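(* Let $d\geq1$, $L\geq1$, $r=\binom{d+L}{d}$, and let $\mathfrak{X}_*^{(r)}$ denote the projective ensemble of $r$ points in $\mathbb{P}(\mathbb{C}^{d+1})$. For $\omega_r=(x_1,\ldots,x_r)\in\mathbb{P}(\mathbb{C}^{d+1})^r$ and $s>0$ let \[ \mathcal{E}^{\mathbb{P}}_s(\omega_r)=\sum_{i\neq j}\frac{1}{\sin\left(d_{\mathbb{P}}(x_i,x_j)\right)^s}. \] Then for $0<s<2d$, \[ \mathbb{E}_{\omega_r\sim\mathfrak{X}_*^{(r)}}\left[\mathcal{E}^{\mathbb{P}}_s(\omega_r)\right]=\frac{d}{d-\frac{s}{2}}r^2-r^2d\,B\!\left(d-\frac{s}{2},L+1\right)=\frac{d}{d-\frac{s}{2}}r^2-r^{1+\frac{s}{2d}}\frac{d\,\Gamma\left(d-\frac{s}{2}\right)}{(d!)^{1-\frac{s}{2d}}}+o\left(r^{1+\frac{s}{2d}}\right) \] as $L\to\infty$, where $B$ is Euler's Beta function. Moreover, $\frac{d}{d-s/2}$ is the continuous $s$-energy $\frac{1}{\mathrm{Vol}(\mathbb{P}(\mathbb{C}^{d+1}))^2}\int\int \sin(d_{\mathbb{P}}(p,q))^{-s}\,dp\,dq$ of the uniform measure on $\mathbb{P}(\mathbb{C}^{d+1})$.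
   Context: $\mathbb{P}(\mathbb{C}^{d+1})$ carries the Fubini–Study metric normalized so that $\sin d_{\mathbb{P}}(p,q)=\sqrt{1-\frac{|\langle p,q\rangle|^2}{\|p\|^2\|q\|^2}}$ (total volume $\pi^d/d!$). The projective ensemble $\mathfrak{X}_*^{(r)}$ is defined as follows: let $\mathcal{H}_{d,L}\subseteq\mathrm{L}^2(\mathbb{C}^d,\mathbb{C})$ be spanned by the $r$ functions $z^\alpha(1+\|z\|^2)^{-\frac{d+L+1}{2}}$, $|\alpha|\leq L$; let $\psi_d:\mathbb{C}^d\to\mathbb{P}(\mathbb{C}^{d+1})$, $z\mapsto(1,z)$, and $\mathcal{H}_*=\{g\circ\psi_d^{-1}\sqrt{|\mathrm{Jac}(\psi_d^{-1})|}:g\in\mathcal{H}_{d,L}\}\subseteq\mathrm{L}^2(\mathbb{P}(\mathbb{C}^{d+1}),\mathbb{C})$. Then $\mathfrak{X}_*^{(r)}$ is the projection determinantal point process of $r$ points with joint intensities $\det(K_*(x_i,x_j))_{i,j}$ (with respect to the Riemannian volume), where $K_*(p,q)=\sum_i\varphi_i(p)\overline{\varphi_i(q)}$ for an orthonormal basis $\{\varphi_i\}$ of $\mathcal{H}_*$; it satisfies $|K_*(p,q)|=\frac{r\,d!}{\pi^d}\left|\left\langle\frac{p}{\|p\|},\frac{q}{\|q\|}\right\rangle\right|^L$. *)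

theory Defs
  imports "HOL-Analysis.Analysis" "Jordan_Normal_Form.Determinant"
begin

text \<open>Points of the affine chart C^d are functions nat => complex (coordinates 0..d-1);
 points of C^(d+1) likewise (coordinates 0..d).\<close>
type_synonym cpt = "nat \<Rightarrow> complex"

definition chart_leb :: "nat \<Rightarrow> cpt measure" where
  "chart_leb d = PiM {..<d} (\<lambda>_. lborel)"

definition sqnorm :: "nat \<Rightarrow> cpt \<Rightarrow> real" where
  "sqnorm n z = (\<Sum>i<n. (cmod (z i))^2)"

definition cinner :: "nat \<Rightarrow> cpt \<Rightarrow> cpt \<Rightarrow> complex" where
  "cinner n p q = (\<Sum>i<n. p i * cnj (q i))"

text \<open>sin of the Fubini--Study distance between the lines spanned by p, q in C^(d+1).\<close>
definition sin_dP :: "nat \<Rightarrow> cpt \<Rightarrow> cpt \<Rightarrow> real" where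
  "sin_dP d p q = sqrt (1 - (cmod (cinner (d+1) p q))^2 / (sqnorm (d+1) p * sqnorm (d+1) q))"

text \<open>The chart psi_d : C^d -> P(C^(d+1)), z |-> (1,z) (a representative vector).\<close>
definition psi :: "cpt \<Rightarrow> cpt" where
  "psi z = (\<lambda>i. if i = 0 then 1 else z (i - 1))"

text \<open>Riemannian (Fubini--Study) volume of P(C^(d+1)), pulled back to the chart
 (the complement of the chart is a null set): density (1+|z|^2)^(-(d+1)) w.r.t. Lebesgue.\<close>
definition fs_vol :: "nat \<Rightarrow> cpt measure" where
  "fs_vol d = density (chart_leb d) (\<lambda>z. ennreal ((1 + sqnorm d z) powr (- (real d + 1))))"

definition midx :: "nat \<Rightarrow> nat \<Rightarrow> (nat \<Rightarrow> nat) set" where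
  "midx d L = {\<alpha>. (\<forall>i\<ge>d. \<alpha> i = 0) \<and> (\<Sum>i<d. \<alpha> i) \<le> L}"

definition mono_fn :: "nat \<Rightarrow> nat \<Rightarrow> (nat \<Rightarrow> nat) \<Rightarrow> cpt \<Rightarrow> complex" where
  "mono_fn d L \<alpha> z = (\<Prod>i<d. z i ^ \<alpha> i) *
      complex_of_real ((1 + sqnorm d z) powr (- (real d + real L + 1) / 2))"

definition H_dL :: "nat \<Rightarrow> nat \<Rightarrow> (cpt \<Rightarrow> complex) set" where
  "H_dL d L = {f. \<exists>c. f = (\<lambda>z. \<Sum>\<alpha>\<in>midx d L. c \<alpha> * mono_fn d L \<alpha> z)}"

definition rL :: "nat \<Rightarrow> nat \<Rightarrow> nat" where
  "rL d L = (d + L) choose d"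

definition is_onb :: "nat \<Rightarrow> nat \<Rightarrow> (nat \<Rightarrow> cpt \<Rightarrow> complex) \<Rightarrow> bool" where
  "is_onb d L \<phi> \<longleftrightarrow>
     (\<forall>i<rL d L. \<phi> i \<in> H_dL d L) \<and>
     (\<forall>i<rL d L. \<forall>j<rL d L. integrable (chart_leb d) (\<lambda>z. \<phi> i z * cnj (\<phi> j z)) \<and>
         (\<integral>z. \<phi> i z * cnj (\<phi> j z) \<partial>chart_leb d) = (if i = j then 1 else 0)) \<and>
     H_dL d L = {f. \<exists>c. f = (\<lambda>z. \<Sum>i<rL d L. c i * \<phi> i z)}"

definition kern :: "nat \<Rightarrow> (nat \<Rightarrow> cpt \<Rightarrow> complex) \<Rightarrow> cpt \<Rightarrow> cpt \<Rightarrow> complex" where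
  "kern r \<phi> z w = (\<Sum>i<r. \<phi> i z * cnj (\<phi> i w))"

text \<open>The projective ensemble of r = rL d L points: law of the (uniformly labelled) tuple,
 density det(K(x_i,x_j))/r! with respect to the product of Lebesgue measures on the chart
 (equivalently det(K_*(x_i,x_j))/r! w.r.t. the Riemannian volume).\<close>
definition proj_ensemble :: "nat \<Rightarrow> nat \<Rightarrow> (nat \<Rightarrow> cpt \<Rightarrow> complex) \<Rightarrow> (nat \<Rightarrow> cpt) measure" where
  "proj_ensemble d L \<phi> =
     density (PiM {..<rL d L} (\<lambda>_. chart_leb d))
       (\<lambda>\<omega>. ennreal (Re (det (mat (rL d L) (rL d L)
                 (\<lambda>(i,j). kern (rL d L) \<phi> (\<omega> i) (\<omega> j)))) / fact (rL d L)))"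

definition energyP :: "nat \<Rightarrow> real \<Rightarrow> nat \<Rightarrow> (nat \<Rightarrow> cpt) \<Rightarrow> real" where
  "energyP d s r \<omega> = (\<Sum>i<r. \<Sum>j<r. if i \<noteq> j
       then 1 / (sin_dP d (psi (\<omega> i)) (psi (\<omega> j))) powr s else 0)"

definition expected_energy :: "nat \<Rightarrow> real \<Rightarrow> nat \<Rightarrow> (nat \<Rightarrow> cpt \<Rightarrow> complex) \<Rightarrow> real" where
  "expected_energy d s L \<phi> = (\<integral>\<omega>. energyP d s (rL d L) \<omega> \<partial>proj_ensemble d L \<phi>)"

end

(*
  For an orthonormal system the determinantal density is |det (phi_j (x_i))|^2 / r!, so the expected
  energy is the double integral of f(x,y) (K(x,x) K(y,y) - |K(x,y)|^2). Since |K(x,y)|^2 is a constant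
  times cos^(2L) of the distance, everything reduces to integrating sin^(-s) cos^(2L). Expand
  sin^(-s) = (1 - cos^2)^(-s/2) in a binomial series: the reproducing property of the degree m kernel
  shows that the normalized integral of cos^(2m) is 1 / binom(d+m, d) = d B(d, m+1), which is also the
  m-th moment of 1 - t under d t^(d-1) dt on [0,1]; resumming gives d B(d - s/2, L+1).
*)
theory Submission
  imports Defs "HOL-Probability.Distributions" "HOL-Real_Asymp.Real_Asymp"
begin

section \<open>Pair statistics of projection determinantal point processes\<close>

text \<open>The orthonormal basis is arbitrary, so nothing is computed from \<phi> itself: the
  kernel of a finite-dimensional span does not depend on the basis, and for normalized monomials the
  multinomial theorem gives it in closed form. Integrability is carried along with every value,
  since the Bochner integral of a non-integrable function is 0 by convention. For the singular
  energy one domination suffices: |\<phi>_k(x)|^2 \<le> K(x,x), which is a constant times the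
  Fubini--Study weight, so each term of the determinant expansion is bounded by the pair integral
  without any power of the cosine. That integral is treated with nonnegative quantities only: the
  coefficients of (1-x)^(-s/2) are nonnegative for s > 0, so sum and integral may be exchanged
  freely, and the result is finite because d - s/2 > 0. The degree L moment d B(d, L+1) equals 1/r;
  hence a single limit, n^a B(a, n+1) -> Gamma(a), yields both r ~ L^d / d! and the second term of
  the expansion.\<close>

lemma (in product_sigma_finite) distr_PiM_pair:
  assumes "x \<noteq> y"
  shows "distr (PiM {x,y} M) (M x \<Otimes>\<^sub>M M y) (\<lambda>\<sigma>. (\<sigma> x, \<sigma> y)) = M x \<Otimes>\<^sub>M M y"
proof (rule measure_eqI)
  fix A assume "A \<in> sets (distr (PiM {x,y} M) (M x \<Otimes>\<^sub>M M y) (\<lambda>\<sigma>. (\<sigma> x, \<sigma> y)))"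
  then have A[measurable]: "A \<in> sets (M x \<Otimes>\<^sub>M M y)" by simp
  have "emeasure (distr (PiM {x,y} M) (M x \<Otimes>\<^sub>M M y) (\<lambda>\<sigma>. (\<sigma> x, \<sigma> y))) A
     = (\<integral>\<^sup>+\<sigma>. indicator A (\<sigma> x, \<sigma> y) \<partial>PiM {x,y} M)"
    by (subst nn_integral_indicator[symmetric], simp) (subst nn_integral_distr, simp_all)
  also have "\<dots> = (\<integral>\<^sup>+z. indicator A (fst z, snd z) \<partial>(M x \<Otimes>\<^sub>M M y))"
    by (rule product_nn_integral_pair) (use assms in \<open>auto simp: case_prod_unfold\<close>)
  finally show "emeasure (distr (PiM {x,y} M) (M x \<Otimes>\<^sub>M M y) (\<lambda>\<sigma>. (\<sigma> x, \<sigma> y))) A = emeasure (M x \<Otimes>\<^sub>M M y) A"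
    by simp
qed simp

lemma (in pair_sigma_finite) has_bochner_integral_mult_pair:
  fixes f :: "_ \<Rightarrow> complex" and g :: "_ \<Rightarrow> complex"
  assumes f: "integrable M1 f" and g: "integrable M2 g"
  shows "has_bochner_integral (M1 \<Otimes>\<^sub>M M2) (\<lambda>(x,y). f x * g y) (integral\<^sup>L M1 f * integral\<^sup>L M2 g)"
proof -
  have [measurable]: "f \<in> borel_measurable M1" "g \<in> borel_measurable M2" using f g by auto
  have i: "integrable (M1 \<Otimes>\<^sub>M M2) (\<lambda>(x,y). f x * g y)"
    by (rule Fubini_integrable) (use f g in \<open>auto simp: norm_mult\<close>)
  have "integral\<^sup>L (M1 \<Otimes>\<^sub>M M2) (\<lambda>(x,y). f x * g y) = (\<integral>x. \<integral>y. f x * g y \<partial>M2 \<partial>M1)"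
    using integral_fst'[OF i] by simp
  also have "\<dots> = integral\<^sup>L M1 f * integral\<^sup>L M2 g" by simp
  finally show ?thesis using i by (simp add: has_bochner_integral_iff)
qed

text \<open>Merging the coordinates {a,b} with the rest turns the integral over I into one over a
  binary product. The factor \<open>h\<close> stays joint in its two coordinates because a singular
  pair interaction does not factor, whereas every other coordinate contributes a one-variable
  integral.\<close>

lemma (in product_sigma_finite) has_bochner_integral_pair_prod:
  fixes h :: "'a \<times> 'a \<Rightarrow> complex" and g :: "'i \<Rightarrow> 'a \<Rightarrow> complex"
  assumes I: "finite I" "a \<in> I" "b \<in> I" "a \<noteq> b"
    and h: "integrable (M a \<Otimes>\<^sub>M M b) h"
    and g: "\<And>i. i \<in> I - {a,b} \<Longrightarrow> integrable (M i) (g i)"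
  shows "has_bochner_integral (PiM I M) (\<lambda>\<omega>. h (\<omega> a, \<omega> b) * (\<Prod>i\<in>I-{a,b}. g i (\<omega> i)))
           (integral\<^sup>L (M a \<Otimes>\<^sub>M M b) h * (\<Prod>i\<in>I-{a,b}. integral\<^sup>L (M i) (g i)))"
proof -
  let ?J = "I - {a,b}"
  interpret P: pair_sigma_finite "PiM {a,b} M" "PiM ?J M"
    by (intro pair_sigma_finite.intro sigma_finite) (use I in auto)
  have IJ: "{a,b} \<union> ?J = I" using I by auto
  have [measurable]: "\<And>i. i \<in> ?J \<Longrightarrow> g i \<in> borel_measurable (M i)" using g by auto
  have [measurable]: "h \<in> borel_measurable (M a \<Otimes>\<^sub>M M b)" using h by auto
  have h': "integrable (PiM {a,b} M) (\<lambda>\<sigma>. h (\<sigma> a, \<sigma> b))"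
    by (subst integrable_distr_eq[where g = "\<lambda>\<sigma>. (\<sigma> a, \<sigma> b)" and N = "M a \<Otimes>\<^sub>M M b", symmetric])
      (use h distr_PiM_pair[OF I(4)] in auto)
  have h'': "(\<integral>\<sigma>. h (\<sigma> a, \<sigma> b) \<partial>PiM {a,b} M) = integral\<^sup>L (M a \<Otimes>\<^sub>M M b) h"
    using integral_distr[of "\<lambda>\<sigma>. (\<sigma> a, \<sigma> b)" "PiM {a,b} M" "M a \<Otimes>\<^sub>M M b" h]
    unfolding distr_PiM_pair[OF I(4)] by simp
  have g': "integrable (PiM ?J M) (\<lambda>y. \<Prod>i\<in>?J. g i (y i))"
    by (rule product_integrable_prod) (use I g in auto)
  have g'': "(\<integral>y. (\<Prod>i\<in>?J. g i (y i)) \<partial>PiM ?J M) = (\<Prod>i\<in>?J. integral\<^sup>L (M i) (g i))"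
    by (rule product_integral_prod) (use I g in auto)
  let ?F = "\<lambda>\<omega>. h (\<omega> a, \<omega> b) * (\<Prod>i\<in>?J. g i (\<omega> i))"
  have F: "?F \<in> borel_measurable (PiM I M)"
    using I by measurable
  have *: "?F (merge {a,b} ?J z) = (\<lambda>(x,y). h (x a, x b) * (\<Prod>i\<in>?J. g i (y i))) z" for z
  proof -
    have "(\<Prod>i\<in>?J. g i (merge {a,b} ?J z i)) = (\<Prod>i\<in>?J. g i (snd z i))"
      by (rule prod.cong) (auto simp: merge_def split: prod.splits)
    then show ?thesis by (auto simp: merge_def split: prod.splits)
  qed
  have m: "merge {a,b} ?J \<in> measurable (PiM {a,b} M \<Otimes>\<^sub>M PiM ?J M) (PiM I M)"
    using measurable_merge[of "{a,b}" ?J M] IJ by simp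
  have d: "PiM I M = distr (PiM {a,b} M \<Otimes>\<^sub>M PiM ?J M) (PiM I M) (merge {a,b} ?J)"
    using distr_merge[of "{a,b}" ?J] I IJ by simp
  have "has_bochner_integral (PiM {a,b} M \<Otimes>\<^sub>M PiM ?J M) (\<lambda>z. ?F (merge {a,b} ?J z))
      (integral\<^sup>L (M a \<Otimes>\<^sub>M M b) h * (\<Prod>i\<in>?J. integral\<^sup>L (M i) (g i)))"
    unfolding * using P.has_bochner_integral_mult_pair[OF h' g'] unfolding h'' g'' .
  then have "has_bochner_integral (distr (PiM {a,b} M \<Otimes>\<^sub>M PiM ?J M) (PiM I M) (merge {a,b} ?J)) ?F
      (integral\<^sup>L (M a \<Otimes>\<^sub>M M b) h * (\<Prod>i\<in>?J. integral\<^sup>L (M i) (g i)))"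
    unfolding has_bochner_integral_iff using F m
    by (subst integrable_distr_eq integral_distr; simp)+
  then show ?thesis using d by simp
qed

text \<open>The permutation \<sigma>^-1 after \<tau> fixes every point outside {a,b}, so it permutes
  a two-element set: it is the identity or the swap.\<close>

lemma permutes_eq_off_two:
  assumes s: "\<sigma> permutes S" and t: "\<tau> permutes S" and ab: "a \<in> S" "b \<in> S" "a \<noteq> b"
    and eq: "\<And>i. i \<in> S - {a,b} \<Longrightarrow> \<sigma> i = \<tau> i"
  shows "\<tau> = \<sigma> \<or> \<tau> = \<sigma> \<circ> Transposition.transpose a b"
proof -
  define \<rho> where "\<rho> = inv_into UNIV \<sigma> \<circ> \<tau>"
  have bs: "bij \<sigma>" using s by (rule permutes_bij)
  have \<rho>: "\<rho> permutes {a,b}"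
    unfolding permutes_def
  proof (intro conjI allI impI)
    have "bij \<rho>" unfolding \<rho>_def using bs permutes_bij[OF t] bij_comp bij_imp_bij_inv by blast
    then show "\<exists>!x. \<rho> x = y" for y by (auto simp: bij_iff)
    fix x assume "x \<notin> {a,b}"
    then have "\<sigma> x = \<tau> x" using eq s t by (cases "x \<in> S") (auto simp: permutes_def)
    then show "\<rho> x = x" unfolding \<rho>_def using bs by (metis comp_apply bij_inv_eq_iff)
  qed
  have "\<tau> = \<sigma> \<circ> \<rho>" unfolding \<rho>_def using bs by (auto simp: fun_eq_iff bij_is_surj surj_f_inv_f)
  moreover have "\<rho> = id \<or> \<rho> = Transposition.transpose a b"
  proof (cases "\<rho> a = a")
    case True
    then have "\<rho> b = b"
      using permutes_in_image[OF \<rho>, of b] permutes_inj[OF \<rho>] ab(3) by (auto simp: inj_def)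
    with True have "\<rho> = id" using \<rho> by (auto simp: fun_eq_iff permutes_def)
    then show ?thesis ..
  next
    case False
    then have "\<rho> a = b" using permutes_in_image[OF \<rho>, of a] by auto
    moreover from this have "\<rho> b = a"
      using permutes_in_image[OF \<rho>, of b] permutes_inj[OF \<rho>] ab(3) by (auto simp: inj_def)
    ultimately have "\<rho> = Transposition.transpose a b"
      using \<rho> by (auto simp: fun_eq_iff permutes_def Transposition.transpose_def)
    then show ?thesis ..
  qed
  ultimately show ?thesis by auto
qed

text \<open>The kernel matrix is A times the transpose of the entrywise conjugate of A, where A has
  entries \<open>\<phi> k (\<omega> i)\<close>; \<open>D\<close> is the Leibniz expansion of det A.
  This form exhibits the density as |det A|^2, hence real and nonnegative, and expands it over pairs
  of permutations with one factor per coordinate.\<close>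

lemma det_gram:
  fixes \<phi> :: "nat \<Rightarrow> 'a \<Rightarrow> complex" and r :: nat
  defines "D \<equiv> \<lambda>\<omega>. \<Sum>p | p permutes {..<r}. of_int (sign p) * (\<Prod>i<r. \<phi> (p i) (\<omega> i))"
  shows "det (mat r r (\<lambda>(i,j). \<Sum>k<r. \<phi> k (\<omega> i) * cnj (\<phi> k (\<omega> j)))) = D \<omega> * cnj (D \<omega>)"
proof -
  define A where "A = mat r r (\<lambda>(i,k). \<phi> k (\<omega> i))"
  define B where "B = mat r r (\<lambda>(i,k). cnj (\<phi> k (\<omega> i)))"
  have c: "A \<in> carrier_mat r r" "B \<in> carrier_mat r r" by (auto simp: A_def B_def)
  have "mat r r (\<lambda>(i,j). \<Sum>k<r. \<phi> k (\<omega> i) * cnj (\<phi> k (\<omega> j))) = A * B\<^sup>T"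
    by (rule eq_matI) (auto simp: A_def B_def scalar_prod_def lessThan_atLeast0)
  then have "det (mat r r (\<lambda>(i,j). \<Sum>k<r. \<phi> k (\<omega> i) * cnj (\<phi> k (\<omega> j)))) = det A * det B"
    using c by (simp add: det_mult det_transpose)
  moreover have p_less: "p i < r" if "p permutes {0..<r}" "i < r" for p i
    using that permutes_in_image[of p "{0..<r}" i] by simp
  have "det A = D \<omega>"
    unfolding det_def'[OF c(1)] D_def lessThan_atLeast0
    by (intro sum.cong prod.cong arg_cong2[where f = "(*)"] refl) (auto simp: A_def p_less)
  moreover have "det B = cnj (D \<omega>)"
    unfolding det_def'[OF c(2)] D_def cnj_sum complex_cnj_mult cnj_prod lessThan_atLeast0
    by (intro sum.cong prod.cong arg_cong2[where f = "(*)"] refl) (auto simp: B_def p_less)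
  ultimately show ?thesis by simp
qed

context sigma_finite_measure
begin

text \<open>Expanding the determinant over pairs of permutations, orthogonality kills every term in which
  the two permutations differ outside the two arguments of the pair statistic; the remaining pairs
  differ at most by a transposition. Summing over all pairs of arguments before reindexing by the
  permutation makes each permutation contribute the same amount, whence the factor \<open>r!\<close>.\<close>

lemma has_bochner_integral_determinantal_pair:
  fixes \<phi> :: "nat \<Rightarrow> 'a \<Rightarrow> complex" and r :: nat and F :: "'a \<Rightarrow> 'a \<Rightarrow> complex"
  defines "K \<equiv> \<lambda>x y. \<Sum>k<r. \<phi> k x * cnj (\<phi> k y)"
  assumes orth: "\<And>i j. i < r \<Longrightarrow> j < r \<Longrightarrow>
      has_bochner_integral M (\<lambda>x. \<phi> i x * cnj (\<phi> j x)) (if i = j then 1 else 0)"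
    and int: "\<And>k k' l l'. k < r \<Longrightarrow> k' < r \<Longrightarrow> l < r \<Longrightarrow> l' < r \<Longrightarrow>
      integrable (M \<Otimes>\<^sub>M M) (\<lambda>(x,y). F x y * (\<phi> k x * cnj (\<phi> k' x)) * (\<phi> l y * cnj (\<phi> l' y)))"
  shows "has_bochner_integral (PiM {..<r} (\<lambda>_. M))
      (\<lambda>\<omega>. (\<Sum>a<r. \<Sum>b<r. if a \<noteq> b then F (\<omega> a) (\<omega> b) else 0)
            * det (mat r r (\<lambda>(i,j). K (\<omega> i) (\<omega> j))))
      (fact r * (\<integral>(x,y). F x y * (K x x * K y y - K x y * K y x) \<partial>(M \<Otimes>\<^sub>M M)))"
proof -
  interpret P: product_sigma_finite "\<lambda>_::nat. M" by standard
  define H where "H k k' l l' =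
      (\<integral>(x,y). F x y * (\<phi> k x * cnj (\<phi> k' x)) * (\<phi> l y * cnj (\<phi> l' y)) \<partial>(M \<Otimes>\<^sub>M M))" for k k' l l'
  define G where "G k l = H k k l l - H k l l k" for k l
  define S where "S = {p. p permutes {..<r}}"
  have finS: "finite S" by (simp add: S_def finite_permutations)
  have lt: "p i < r" if "p \<in> S" "i < r" for p i
    using that permutes_in_image[of p "{..<r}" i] by (simp add: S_def)
  have term1: "has_bochner_integral (PiM {..<r} (\<lambda>_. M))
      (\<lambda>\<omega>. F (\<omega> a) (\<omega> b) * (\<Prod>i<r. \<phi> (\<sigma> i) (\<omega> i) * cnj (\<phi> (\<tau> i) (\<omega> i))))
      (H (\<sigma> a) (\<tau> a) (\<sigma> b) (\<tau> b) * (if \<forall>i\<in>{..<r}-{a,b}. \<sigma> i = \<tau> i then 1 else 0))"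
    if "\<sigma> \<in> S" "\<tau> \<in> S" "a < r" "b < r" "a \<noteq> b" for \<sigma> \<tau> a b
  proof -
    let ?h = "\<lambda>(x,y). F x y * (\<phi> (\<sigma> a) x * cnj (\<phi> (\<tau> a) x)) * (\<phi> (\<sigma> b) y * cnj (\<phi> (\<tau> b) y))"
    let ?g = "\<lambda>i x. \<phi> (\<sigma> i) x * cnj (\<phi> (\<tau> i) x)"
    have "has_bochner_integral (PiM {..<r} (\<lambda>_. M))
        (\<lambda>\<omega>. ?h (\<omega> a, \<omega> b) * (\<Prod>i\<in>{..<r}-{a,b}. ?g i (\<omega> i)))
        (integral\<^sup>L (M \<Otimes>\<^sub>M M) ?h * (\<Prod>i\<in>{..<r}-{a,b}. integral\<^sup>L M (?g i)))"
      by (rule P.has_bochner_integral_pair_prod)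
         (use that lt in \<open>auto intro!: int has_bochner_integral_integrable orth
            intro: integrable.intros[OF orth]\<close>)
    also have "(\<lambda>\<omega>. ?h (\<omega> a, \<omega> b) * (\<Prod>i\<in>{..<r}-{a,b}. ?g i (\<omega> i)))
        = (\<lambda>\<omega>. F (\<omega> a) (\<omega> b) * (\<Prod>i<r. ?g i (\<omega> i)))"
    proof
      fix \<omega>
      have "(\<Prod>i<r. ?g i (\<omega> i)) = ?g a (\<omega> a) * (?g b (\<omega> b) * (\<Prod>i\<in>{..<r}-{a}-{b}. ?g i (\<omega> i)))"
        using that by (subst prod.remove[of _ a], simp, simp) (subst prod.remove[of _ b], auto)
      moreover have "{..<r}-{a}-{b} = {..<r}-{a,b}" by auto
      ultimately show "?h (\<omega> a, \<omega> b) * (\<Prod>i\<in>{..<r}-{a,b}. ?g i (\<omega> i))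
          = F (\<omega> a) (\<omega> b) * (\<Prod>i<r. ?g i (\<omega> i))"
        by (simp add: mult_ac)
    qed
    also have "(\<Prod>i\<in>{..<r}-{a,b}. integral\<^sup>L M (?g i)) = (\<Prod>i\<in>{..<r}-{a,b}. if \<sigma> i = \<tau> i then 1 else 0)"
      using that lt by (intro prod.cong refl has_bochner_integral_integral_eq orth) auto
    also have "\<dots> = (if \<forall>i\<in>{..<r}-{a,b}. \<sigma> i = \<tau> i then 1 else 0)"
      by (auto intro!: prod.neutral)
    also have "integral\<^sup>L (M \<Otimes>\<^sub>M M) ?h = H (\<sigma> a) (\<tau> a) (\<sigma> b) (\<tau> b)" by (simp add: H_def)
    finally show ?thesis .
  qed
  have term2: "has_bochner_integral (PiM {..<r} (\<lambda>_. M))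
      (\<lambda>\<omega>. F (\<omega> a) (\<omega> b) * det (mat r r (\<lambda>(i,j). K (\<omega> i) (\<omega> j))))
      (\<Sum>\<sigma>\<in>S. G (\<sigma> a) (\<sigma> b))"
    if ab: "a < r" "b < r" "a \<noteq> b" for a b
  proof -
    let ?c = "\<lambda>\<sigma> \<tau>. if \<forall>i\<in>{..<r}-{a,b}. \<sigma> i = \<tau> i then 1 else (0::complex)"
    let ?sg = "\<lambda>\<sigma> \<tau>. of_int (sign \<sigma>) * of_int (sign \<tau>) :: complex"
    have "has_bochner_integral (PiM {..<r} (\<lambda>_. M))
      (\<lambda>\<omega>. \<Sum>\<sigma>\<in>S. \<Sum>\<tau>\<in>S. ?sg \<sigma> \<tau> *
          (F (\<omega> a) (\<omega> b) * (\<Prod>i<r. \<phi> (\<sigma> i) (\<omega> i) * cnj (\<phi> (\<tau> i) (\<omega> i)))))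
      (\<Sum>\<sigma>\<in>S. \<Sum>\<tau>\<in>S. ?sg \<sigma> \<tau> * (H (\<sigma> a) (\<tau> a) (\<sigma> b) (\<tau> b) * ?c \<sigma> \<tau>))"
      by (intro has_bochner_integral_sum has_bochner_integral_mult_right term1 ab)
    also have "(\<lambda>\<omega>. \<Sum>\<sigma>\<in>S. \<Sum>\<tau>\<in>S. ?sg \<sigma> \<tau> *
          (F (\<omega> a) (\<omega> b) * (\<Prod>i<r. \<phi> (\<sigma> i) (\<omega> i) * cnj (\<phi> (\<tau> i) (\<omega> i)))))
        = (\<lambda>\<omega>. F (\<omega> a) (\<omega> b) * det (mat r r (\<lambda>(i,j). K (\<omega> i) (\<omega> j))))"
      unfolding K_def det_gram cnj_sum complex_cnj_mult cnj_prod sum_product S_def[symmetric]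
      unfolding sum_distrib_left prod.distrib
      by (intro ext sum.cong refl) (simp add: mult_ac)
    also have "(\<Sum>\<sigma>\<in>S. \<Sum>\<tau>\<in>S. ?sg \<sigma> \<tau> * (H (\<sigma> a) (\<tau> a) (\<sigma> b) (\<tau> b) * ?c \<sigma> \<tau>))
        = (\<Sum>\<sigma>\<in>S. G (\<sigma> a) (\<sigma> b))"
    proof (rule sum.cong[OF refl])
      fix \<sigma> assume \<sigma>: "\<sigma> \<in> S"
      \<comment> \<open>For fixed \<sigma> only \<tau> = \<sigma> and \<tau> = \<open>?t\<close>
        survive. They carry opposite signs, which gives a direct term minus an exchange term, that
        is \<open>G\<close>.\<close>
      let ?t = "\<sigma> \<circ> Transposition.transpose a b"
      have tS: "?t \<in> S" using \<sigma> ab permutes_compose[of "Transposition.transpose a b" "{..<r}" \<sigma>]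
        by (simp add: S_def permutes_swap_id)
      have inj: "\<sigma> a \<noteq> \<sigma> b" using \<sigma> ab permutes_inj[of \<sigma>] by (auto simp: S_def inj_def)
      then have ne: "?t \<noteq> \<sigma>" using ab by (metis comp_apply transpose_apply_first)
      have perm: "permutation p" if "p \<in> S" for p
        using that permutation_permutes[of p] by (auto simp: S_def)
      have sg: "?sg \<sigma> ?t = -1"
        using sign_compose[OF perm[OF \<sigma>] permutation_swap_id] ab
        by (simp add: sign_swap_id of_int_mult[symmetric] sign_idempotent del: of_int_mult)
      have sg': "?sg \<sigma> \<sigma> = 1" by (simp add: sign_def)
      have "(\<Sum>\<tau>\<in>S. ?sg \<sigma> \<tau> * (H (\<sigma> a) (\<tau> a) (\<sigma> b) (\<tau> b) * ?c \<sigma> \<tau>))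
        = (\<Sum>\<tau>\<in>{\<sigma>, ?t}. ?sg \<sigma> \<tau> * (H (\<sigma> a) (\<tau> a) (\<sigma> b) (\<tau> b) * ?c \<sigma> \<tau>))"
      proof (rule sum.mono_neutral_right[OF finS], use \<sigma> tS in simp, rule ballI)
        fix \<tau> assume \<tau>: "\<tau> \<in> S - {\<sigma>, ?t}"
        then have "?c \<sigma> \<tau> = 0"
          using permutes_eq_off_two[of \<sigma> "{..<r}" \<tau> a b] \<sigma> ab by (auto simp: S_def)
        then show "?sg \<sigma> \<tau> * (H (\<sigma> a) (\<tau> a) (\<sigma> b) (\<tau> b) * ?c \<sigma> \<tau>) = 0" by (simp only: mult_zero_right)
      qed
      also have "\<dots> = H (\<sigma> a) (\<sigma> a) (\<sigma> b) (\<sigma> b) - H (\<sigma> a) (\<sigma> b) (\<sigma> b) (\<sigma> a)"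
      proof -
        have "?c \<sigma> ?t = 1" by (auto simp: transpose_apply_other)
        moreover have "?c \<sigma> \<sigma> = 1" by simp
        moreover have "?t a = \<sigma> b" "?t b = \<sigma> a" by auto
        ultimately show ?thesis using ne sg sg' by (simp del: comp_apply)
      qed
      finally show "(\<Sum>\<tau>\<in>S. ?sg \<sigma> \<tau> * (H (\<sigma> a) (\<tau> a) (\<sigma> b) (\<tau> b) * ?c \<sigma> \<tau>)) = G (\<sigma> a) (\<sigma> b)"
        by (simp add: G_def)
    qed
    finally show ?thesis .
  qed
  have GI: "has_bochner_integral (M \<Otimes>\<^sub>M M) (\<lambda>(x,y). F x y * (K x x * K y y - K x y * K y x))
      (\<Sum>k<r. \<Sum>l<r. G k l)"
  proof -
    have "has_bochner_integral (M \<Otimes>\<^sub>M M) (\<lambda>z. \<Sum>k<r. \<Sum>l<r.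
       (case z of (x,y) \<Rightarrow> F x y * (\<phi> k x * cnj (\<phi> k x)) * (\<phi> l y * cnj (\<phi> l y)))
       - (case z of (x,y) \<Rightarrow> F x y * (\<phi> k x * cnj (\<phi> l x)) * (\<phi> l y * cnj (\<phi> k y))))
      (\<Sum>k<r. \<Sum>l<r. G k l)"
      unfolding G_def H_def
      by (intro has_bochner_integral_sum has_bochner_integral_diff has_bochner_integral_integrable int) auto
    also have "(\<lambda>z. \<Sum>k<r. \<Sum>l<r.
       (case z of (x,y) \<Rightarrow> F x y * (\<phi> k x * cnj (\<phi> k x)) * (\<phi> l y * cnj (\<phi> l y)))
       - (case z of (x,y) \<Rightarrow> F x y * (\<phi> k x * cnj (\<phi> l x)) * (\<phi> l y * cnj (\<phi> k y))))
       = (\<lambda>(x,y). F x y * (K x x * K y y - K x y * K y x))"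
    proof
      fix z :: "'a \<times> 'a"
      obtain x y where z: "z = (x,y)" by (cases z)
      show "(\<Sum>k<r. \<Sum>l<r.
       (case z of (x,y) \<Rightarrow> F x y * (\<phi> k x * cnj (\<phi> k x)) * (\<phi> l y * cnj (\<phi> l y)))
       - (case z of (x,y) \<Rightarrow> F x y * (\<phi> k x * cnj (\<phi> l x)) * (\<phi> l y * cnj (\<phi> k y))))
       = (case z of (x,y) \<Rightarrow> F x y * (K x x * K y y - K x y * K y x))"
        unfolding z K_def sum_product prod.case
        unfolding sum_subtractf[symmetric]
        unfolding sum_distrib_left
        by (intro sum.cong refl) (simp add: algebra_simps)
    qed
    finally show ?thesis .
  qed
  have "has_bochner_integral (PiM {..<r} (\<lambda>_. M))
      (\<lambda>\<omega>. \<Sum>a<r. \<Sum>b<r. if a \<noteq> b then F (\<omega> a) (\<omega> b) * det (mat r r (\<lambda>(i,j). K (\<omega> i) (\<omega> j))) else 0)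
      (\<Sum>a<r. \<Sum>b<r. if a \<noteq> b then \<Sum>\<sigma>\<in>S. G (\<sigma> a) (\<sigma> b) else 0)"
    by (intro has_bochner_integral_sum) (auto intro!: term2)
  also have "(\<lambda>\<omega>. \<Sum>a<r. \<Sum>b<r. if a \<noteq> b then F (\<omega> a) (\<omega> b) * det (mat r r (\<lambda>(i,j). K (\<omega> i) (\<omega> j))) else 0)
     = (\<lambda>\<omega>. (\<Sum>a<r. \<Sum>b<r. if a \<noteq> b then F (\<omega> a) (\<omega> b) else 0)
            * det (mat r r (\<lambda>(i,j). K (\<omega> i) (\<omega> j))))"
    unfolding sum_distrib_right by (intro ext sum.cong refl) simp
  \<comment> \<open>The condition a \<noteq> b may be dropped because \<open>G k k\<close> is a
    difference of two equal integrals. Only then does reindexing by \<sigma> separate into two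
    independent sums.\<close>
  also have "(\<Sum>a<r. \<Sum>b<r. if a \<noteq> b then \<Sum>\<sigma>\<in>S. G (\<sigma> a) (\<sigma> b) else 0)
      = (\<Sum>a<r. \<Sum>b<r. \<Sum>\<sigma>\<in>S. G (\<sigma> a) (\<sigma> b))"
    by (intro sum.cong refl) (auto simp: G_def)
  also have "\<dots> = (\<Sum>a<r. \<Sum>\<sigma>\<in>S. \<Sum>b<r. G (\<sigma> a) (\<sigma> b))"
    by (intro sum.cong refl sum.swap)
  also have "\<dots> = (\<Sum>\<sigma>\<in>S. \<Sum>a<r. \<Sum>b<r. G (\<sigma> a) (\<sigma> b))"
    by (rule sum.swap)
  also have "\<dots> = (\<Sum>\<sigma>\<in>S. \<Sum>k<r. \<Sum>l<r. G k l)"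
  proof (rule sum.cong[OF refl])
    fix \<sigma> assume "\<sigma> \<in> S"
    then have b: "bij_betw \<sigma> {..<r} {..<r}" by (simp add: S_def permutes_imp_bij)
    show "(\<Sum>a<r. \<Sum>b<r. G (\<sigma> a) (\<sigma> b)) = (\<Sum>k<r. \<Sum>l<r. G k l)"
      by (subst sum.reindex_bij_betw[OF b, of "\<lambda>k. \<Sum>b<r. G k (\<sigma> b)"])
         (intro sum.cong refl sum.reindex_bij_betw[OF b])
  qed
  also have "\<dots> = fact r * (\<Sum>k<r. \<Sum>l<r. G k l)"
    by (simp add: S_def card_permutations)
  also have "(\<Sum>k<r. \<Sum>l<r. G k l)
      = (\<integral>(x,y). F x y * (K x x * K y y - K x y * K y x) \<partial>(M \<Otimes>\<^sub>M M))"
    using GI by (simp add: has_bochner_integral_iff)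
  finally show ?thesis .
qed

end

section \<open>Rotations and Gaussian moments in the complex plane\<close>

text \<open>Lebesgue measure on the plane is determined by boxes with respect to the basis 1, i, and
  these pull back to products of intervals. The identification lets shears act on one real
  coordinate at a time.\<close>

lemma distr_Complex: "distr (lborel \<Otimes>\<^sub>M lborel) borel (\<lambda>(x,y). Complex x y) = lborel"
proof (rule lborel_eqI[symmetric])
  have [measurable]: "(\<lambda>(x,y). Complex x y) \<in> borel_measurable (borel \<Otimes>\<^sub>M borel)"
    unfolding Complex_eq by measurable
  fix l u :: complex
  assume "\<And>b. b \<in> Basis \<Longrightarrow> l \<bullet> b \<le> u \<bullet> b"
  from this[of 1] this[of \<i>] have lu: "Re l \<le> Re u" "Im l \<le> Im u"
    by (auto simp: Basis_complex_def)
  have "(\<lambda>(x,y). Complex x y) -` box l u = {Re l<..<Re u} \<times> {Im l<..<Im u}"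
    by (auto simp: box_def Basis_complex_def)
  then have "emeasure (distr (lborel \<Otimes>\<^sub>M lborel) borel (\<lambda>(x,y). Complex x y)) (box l u)
     = emeasure (lborel \<Otimes>\<^sub>M lborel) ({Re l<..<Re u} \<times> {Im l<..<Im u})"
    by (subst emeasure_distr) (auto simp: space_pair_measure)
  also have "\<dots> = ennreal (\<Prod>b\<in>Basis. (u - l) \<bullet> b)"
    using lu by (subst lborel.emeasure_pair_measure_Times) (auto simp: Basis_complex_def ennreal_mult)
  finally show "emeasure (distr (lborel \<Otimes>\<^sub>M lborel) borel (\<lambda>(x,y). Complex x y)) (box l u)
     = ennreal (\<Prod>b\<in>Basis. (u - l) \<bullet> b)" .
qed simp

lemma nn_integral_lborel_complex:
  fixes f :: "complex \<Rightarrow> ennreal"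
  assumes [measurable]: "f \<in> borel_measurable borel"
  shows "(\<integral>\<^sup>+z. f z \<partial>lborel) = (\<integral>\<^sup>+x. \<integral>\<^sup>+y. f (Complex x y) \<partial>lborel \<partial>lborel)"
proof -
  have [measurable]: "(\<lambda>(x,y). Complex x y) \<in> borel_measurable (borel \<Otimes>\<^sub>M borel)"
    unfolding Complex_eq by measurable
  have "(\<integral>\<^sup>+z. f z \<partial>lborel) = (\<integral>\<^sup>+p. f (case p of (x,y) \<Rightarrow> Complex x y) \<partial>(lborel \<Otimes>\<^sub>M lborel))"
    by (subst distr_Complex[symmetric]) (subst nn_integral_distr, auto)
  also have "\<dots> = (\<integral>\<^sup>+x. \<integral>\<^sup>+y. f (Complex x y) \<partial>lborel \<partial>lborel)"
    by (subst lborel.nn_integral_fst[symmetric]) auto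
  finally show ?thesis .
qed

text \<open>A rotation other than \<open>z \<mapsto> -z\<close> is a product of three shears, each of which preserves area
  by translation invariance on lines.\<close>

lemma nn_integral_rotate_complex:
  fixes f :: "complex \<Rightarrow> ennreal"
  assumes f[measurable]: "f \<in> borel_measurable borel" and u: "cmod u = 1" "Re u \<noteq> -1"
  shows "(\<integral>\<^sup>+z. f (u * z) \<partial>lborel) = (\<integral>\<^sup>+z. f z \<partial>lborel)"
proof -
  have [measurable]: "(\<lambda>(x,y). Complex x y) \<in> borel_measurable (borel \<Otimes>\<^sub>M borel)"
    unfolding Complex_eq by measurable
  \<comment> \<open>For u = cis \<theta> these are a = -tan(\<theta>/2) and b = sin \<theta>: the
    rotation is the horizontal shear by a, then the vertical one by b, then the horizontal one by a
    again. At u = -1 the parameter a would be infinite.\<close>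
  define a b where "a = - Im u / (1 + Re u)" and "b = Im u"
  define h where "h = (\<lambda>(x,y). f (Complex x y))"
  define I where "I g = (\<integral>\<^sup>+x. \<integral>\<^sup>+y. g (x,y) \<partial>lborel \<partial>lborel)" for g :: "real \<times> real \<Rightarrow> ennreal"
  have h[measurable]: "h \<in> borel_measurable (borel \<Otimes>\<^sub>M borel)" unfolding h_def by measurable
  have trans: "(\<integral>\<^sup>+x. g (x + t) \<partial>lborel) = (\<integral>\<^sup>+x. g x \<partial>lborel)"
    if [measurable]: "g \<in> borel_measurable borel" for g :: "real \<Rightarrow> ennreal" and t
    using nn_integral_real_affine[of g 1 t] that by (simp add: add.commute)
  have swap: "I g = (\<integral>\<^sup>+y. \<integral>\<^sup>+x. g (x,y) \<partial>lborel \<partial>lborel)"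
    if [measurable]: "g \<in> borel_measurable (borel \<Otimes>\<^sub>M borel)" for g
    unfolding I_def by (rule lborel_pair.Fubini') (simp add: case_prod_unfold)
  \<comment> \<open>A horizontal shear translates x by an amount that depends on y, so x has to
    become the inner variable.\<close>
  have sx: "I (\<lambda>(x,y). g (x + c * y, y)) = I g"
    if [measurable]: "g \<in> borel_measurable (borel \<Otimes>\<^sub>M borel)" for g c
    by (subst (1 2) swap) (auto intro!: nn_integral_cong trans)
  have sy: "I (\<lambda>(x,y). g (x, y + c * x)) = I g"
    if [measurable]: "g \<in> borel_measurable (borel \<Otimes>\<^sub>M borel)" for g c
    unfolding I_def by (auto intro!: nn_integral_cong trans)
  have n: "(Re u)\<^sup>2 + (Im u)\<^sup>2 = 1" using u by (simp add: cmod_def)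
  have nz: "1 + Re u \<noteq> 0" using u by auto
  have ab: "1 + a * b = Re u" "a * (1 + Re u) = - Im u"
    using n nz by (auto simp: a_def b_def field_simps power2_eq_square)
  have *: "h (x + a * y + a * (y + b * (x + a * y)), y + b * (x + a * y)) = f (u * Complex x y)" for x y
  proof -
    have "y + b * (x + a * y) = (1 + a * b) * y + b * x" by (simp add: algebra_simps)
    then have 1: "y + b * (x + a * y) = Re u * y + Im u * x" unfolding ab by (simp add: b_def)
    have "x + a * y + a * (Re u * y + Im u * x) = (1 + a * b) * x + a * (1 + Re u) * y"
      by (simp add: algebra_simps b_def)
    then have 2: "x + a * y + a * (Re u * y + Im u * x) = Re u * x - Im u * y"
      unfolding ab by simp
    have "u * Complex x y = Complex (Re u * x - Im u * y) (Re u * y + Im u * x)"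
      by (simp add: complex_eq_iff)
    then show ?thesis unfolding 1 2 by (simp add: h_def)
  qed
  have "(\<integral>\<^sup>+z. f (u * z) \<partial>lborel) = I (\<lambda>(x,y). f (u * Complex x y))"
    unfolding I_def by (subst nn_integral_lborel_complex) auto
  also have "\<dots> = I (\<lambda>(x,y). (\<lambda>(x,y). (\<lambda>(x,y). h (x + a * y, y)) (x, y + b * x)) (x + a * y, y))"
    unfolding prod.case * ..
  also have "\<dots> = I (\<lambda>(x,y). (\<lambda>(x,y). h (x + a * y, y)) (x, y + b * x))"
    by (rule sx) measurable
  also have "\<dots> = I (\<lambda>(x,y). h (x + a * y, y))" by (rule sy) measurable
  also have "\<dots> = I h" by (rule sx) measurable
  also have "\<dots> = (\<integral>\<^sup>+z. f z \<partial>lborel)"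
    unfolding I_def h_def by (subst nn_integral_lborel_complex) auto
  finally show ?thesis .
qed

section \<open>Radial integration in the complex plane\<close>

text \<open>The disc |z|^2 < x has area pi x, so the image measure has constant density pi on the
  half-line. This takes the place of polar coordinates.\<close>

lemma distr_cmod_sq:
  "distr lborel borel (\<lambda>z::complex. (cmod z)\<^sup>2) = density lborel (\<lambda>t. ennreal pi * indicator {0..} t)"
  (is "?L = ?R")
proof (rule measure_eqI_generator_eq[where E = "range (\<lambda>x::real. {..<x})" and \<Omega> = UNIV
      and A = "\<lambda>n. {..<real n}"])
  show "Int_stable (range (\<lambda>x::real. {..<x}))"
  proof -
    have "{..<a} \<inter> {..<b} = {..<min a b}" for a b :: real by auto
    then show ?thesis by (auto simp: Int_stable_def)
  qed
  \<comment> \<open>The maximum covers negative x too: the disc then has radius 0 and the open ball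
    is empty.\<close>
  have *: "emeasure ?L {..<x} = ennreal (pi * max 0 x)" "emeasure ?R {..<x} = ennreal (pi * max 0 x)" for x
  proof -
    have "{z::complex. (cmod z)\<^sup>2 < x} = ball 0 (sqrt (max 0 x))"
    proof (cases "x \<le> 0")
      case True
      then show ?thesis by (auto simp: not_less intro: order.trans)
    next
      case False
      then have "(cmod z)\<^sup>2 < x \<longleftrightarrow> cmod z < sqrt x" for z
        by (metis norm_ge_zero real_sqrt_less_iff real_sqrt_abs abs_of_nonneg)
      moreover have "max 0 x = x" using False by simp
      ultimately show ?thesis by (simp only: ball_def dist_0_norm)
    qed
    moreover have "emeasure lborel (ball (0::complex) (sqrt (max 0 x))) = ennreal (pi * max 0 x)"
      by (subst emeasure_ball) (auto simp: unit_ball_vol_2)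
    ultimately show "emeasure ?L {..<x} = ennreal (pi * max 0 x)"
      by (subst emeasure_distr) (auto simp: vimage_def)
    have "emeasure ?R {..<x} = (\<integral>\<^sup>+t. ennreal pi * indicator {0..<x} t \<partial>lborel)"
      by (subst emeasure_density) (auto intro!: nn_integral_cong simp: indicator_def)
    also have "\<dots> = ennreal pi * emeasure lborel {0..<x}"
      by (subst nn_integral_cmult_indicator) auto
    also have "\<dots> = ennreal (pi * max 0 x)"
      by (cases "x \<le> 0") (auto simp: max_def ennreal_mult)
    finally show "emeasure ?R {..<x} = ennreal (pi * max 0 x)" .
  qed
  show "\<And>X. X \<in> range (\<lambda>x::real. {..<x}) \<Longrightarrow> emeasure ?L X = emeasure ?R X"
    using * by auto
  show "sets ?L = sigma_sets UNIV (range (\<lambda>x::real. {..<x}))" "sets ?R = sigma_sets UNIV (range (\<lambda>x::real. {..<x}))"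
    by (simp_all add: borel_Iio)
  show "(\<Union>i. {..<real i}) = UNIV" by (auto intro: reals_Archimedean2)
  show "emeasure ?L {..<real i} \<noteq> \<infinity>" for i using * by simp
qed auto

lemma nn_integral_cmod_sq:
  assumes [measurable]: "f \<in> borel_measurable borel"
  shows "(\<integral>\<^sup>+z. f ((cmod z)\<^sup>2) \<partial>lborel) = ennreal pi * (\<integral>\<^sup>+t. f t * indicator {0..} t \<partial>lborel)"
proof -
  have "(\<integral>\<^sup>+z. f ((cmod z)\<^sup>2) \<partial>lborel) = integral\<^sup>N (distr lborel borel (\<lambda>z::complex. (cmod z)\<^sup>2)) f"
    by (subst nn_integral_distr) auto
  also have "\<dots> = (\<integral>\<^sup>+t. ennreal pi * (f t * indicator {0..} t) \<partial>lborel)"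
    unfolding distr_cmod_sq by (subst nn_integral_density) (auto simp: mult_ac)
  also have "\<dots> = ennreal pi * (\<integral>\<^sup>+t. f t * indicator {0..} t \<partial>lborel)"
    by (rule nn_integral_cmult) measurable
  finally show ?thesis .
qed

text \<open>Scaling t in the Gamma integral for k!. It is used in two directions: with c = 1 + |z|^2
  to write the weight as an integral over t, and with c = t to evaluate the Gaussian moments that
  this produces.\<close>

lemma nn_integral_power_times_exp:
  fixes c :: real assumes c: "c > 0"
  shows "(\<integral>\<^sup>+t. ennreal (t ^ k * exp (- (c * t))) * indicator {0..} t \<partial>lborel) = ennreal (fact k / c ^ Suc k)"
proof -
  have "ennreal (fact k) = (\<integral>\<^sup>+t. ennreal (t ^ k * exp (- t)) * indicator {0..} t \<partial>lborel)"
    by (simp add: nn_intergal_power_times_exp_Ici)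
  also have "\<dots> = ennreal c * (\<integral>\<^sup>+t. ennreal ((c * t) ^ k * exp (- (c * t))) * indicator {0..} (c * t) \<partial>lborel)"
    using c by (subst nn_integral_real_affine[where c = c and t = 0]) auto
  also have "(\<integral>\<^sup>+t. ennreal ((c * t) ^ k * exp (- (c * t))) * indicator {0..} (c * t) \<partial>lborel)
     = (\<integral>\<^sup>+t. ennreal (c ^ k) * (ennreal (t ^ k * exp (- (c * t))) * indicator {0..} t) \<partial>lborel)"
    using c by (intro nn_integral_cong)
      (auto simp: indicator_def zero_le_mult_iff ennreal_mult[symmetric] power_mult_distrib mult_ac)
  also have "\<dots> = ennreal (c ^ k) * (\<integral>\<^sup>+t. ennreal (t ^ k * exp (- (c * t))) * indicator {0..} t \<partial>lborel)"
    by (rule nn_integral_cmult) measurable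
  finally have *: "ennreal (fact k) = ennreal (c ^ Suc k) * (\<integral>\<^sup>+t. ennreal (t ^ k * exp (- (c * t))) * indicator {0..} t \<partial>lborel)"
    using c by (simp add: ennreal_mult mult_ac)
  have "ennreal (fact k / c ^ Suc k) = ennreal (1 / c ^ Suc k) * ennreal (fact k)"
    using c by (simp add: ennreal_mult[symmetric])
  also have "\<dots> = ennreal (1 / c ^ Suc k * c ^ Suc k) * (\<integral>\<^sup>+t. ennreal (t ^ k * exp (- (c * t))) * indicator {0..} t \<partial>lborel)"
    unfolding * using c by (subst ennreal_mult) (auto simp: mult_ac)
  finally show ?thesis using c by simp
qed

lemma nn_integral_complex_gaussian_moment:
  assumes "c > 0"
  shows "(\<integral>\<^sup>+z. ennreal ((cmod z)\<^sup>2 ^ k * exp (- (c * (cmod z)\<^sup>2))) \<partial>lborel) = ennreal (pi * fact k / c ^ Suc k)"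
proof -
  have "(\<integral>\<^sup>+z. ennreal ((cmod z)\<^sup>2 ^ k * exp (- (c * (cmod z)\<^sup>2))) \<partial>lborel)
     = ennreal pi * ennreal (fact k / c ^ Suc k)"
    unfolding nn_integral_power_times_exp[OF assms, symmetric]
    by (rule nn_integral_cmod_sq) measurable
  also have "\<dots> = ennreal (pi * fact k / c ^ Suc k)"
    using assms by (subst ennreal_mult[symmetric]) auto
  finally show ?thesis .
qed

section \<open>Orthogonality of monomials in the affine chart\<close>

lemma product_sigma_finite_lborel: "product_sigma_finite (\<lambda>_. lborel :: complex measure)"
  by standard

lemma cnj_borel_measurable [measurable]: "cnj \<in> borel_measurable borel"
  by (intro borel_measurable_continuous_onI continuous_intros)

lemma sets_chart_leb [measurable_cong]: "sets (chart_leb d) = sets (PiM {..<d} (\<lambda>_. borel))"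
  unfolding chart_leb_def by (rule sets_PiM_cong) auto

lemma sigma_finite_chart_leb: "sigma_finite_measure (chart_leb d)"
  unfolding chart_leb_def
  by (rule product_sigma_finite.sigma_finite[OF product_sigma_finite_lborel]) simp

lemma sqnorm_measurable [measurable]: "sqnorm d \<in> borel_measurable (PiM {..<d} (\<lambda>_. borel))"
  unfolding sqnorm_def by measurable

lemma mono_fn_measurable [measurable]: "mono_fn d L \<alpha> \<in> borel_measurable (PiM {..<d} (\<lambda>_. borel))"
  unfolding mono_fn_def by measurable

lemma sqnorm_nonneg [simp]: "0 \<le> sqnorm d z"
  by (simp add: sqnorm_def sum_nonneg)

lemma sqnorm_pos [simp]: "0 < 1 + sqnorm d z"
  using sqnorm_nonneg[of d z] by linarith

text \<open>Writing the weight as a Gamma integral in \<open>t\<close> turns the integrand into a product of Gaussian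
  moments of the single coordinates.\<close>

lemma nn_integral_chart_monomial:
  fixes \<alpha> :: "nat \<Rightarrow> nat" and d m :: nat
  defines "N \<equiv> d + (\<Sum>i<d. \<alpha> i) + m"
  shows "(\<integral>\<^sup>+z. ennreal ((\<Prod>i<d. (cmod (z i))\<^sup>2 ^ \<alpha> i) / (1 + sqnorm d z) ^ Suc N) \<partial>chart_leb d)
       = ennreal (pi ^ d * (\<Prod>i<d. fact (\<alpha> i)) * fact m / fact N)"
proof -
  interpret P: product_sigma_finite "\<lambda>_::nat. lborel :: complex measure"
    by (rule product_sigma_finite_lborel)
  interpret C: sigma_finite_measure "chart_leb d" by (rule sigma_finite_chart_leb)
  interpret CL: pair_sigma_finite "chart_leb d" "lborel :: real measure" ..
  let ?p = "\<lambda>z. \<Prod>i<d. (cmod (z i))\<^sup>2 ^ \<alpha> i"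
  let ?c = "pi ^ d * (\<Prod>i<d. fact (\<alpha> i)) / fact N :: real"
  have "(\<integral>\<^sup>+z. ennreal (?p z / (1 + sqnorm d z) ^ Suc N) \<partial>chart_leb d)
      = (\<integral>\<^sup>+z. \<integral>\<^sup>+t. ennreal (?p z / fact N) * (ennreal (t ^ N * exp (- ((1 + sqnorm d z) * t))) * indicator {0..} t)
           \<partial>lborel \<partial>chart_leb d)"
  proof (rule nn_integral_cong)
    fix z :: cpt
    have "ennreal (?p z / (1 + sqnorm d z) ^ Suc N) = ennreal (?p z / fact N) * ennreal (fact N / (1 + sqnorm d z) ^ Suc N)"
      by (subst ennreal_mult[symmetric]) (auto intro!: divide_nonneg_nonneg prod_nonneg)
    also have "\<dots> = ennreal (?p z / fact N) * (\<integral>\<^sup>+t. ennreal (t ^ N * exp (- ((1 + sqnorm d z) * t))) * indicator {0..} t \<partial>lborel)"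
      by (subst nn_integral_power_times_exp) auto
    also have "\<dots> = (\<integral>\<^sup>+t. ennreal (?p z / fact N) * (ennreal (t ^ N * exp (- ((1 + sqnorm d z) * t))) * indicator {0..} t) \<partial>lborel)"
      by (rule nn_integral_cmult[symmetric]) measurable
    finally show "ennreal (?p z / (1 + sqnorm d z) ^ Suc N) = \<dots>" .
  qed
  also have "\<dots> = (\<integral>\<^sup>+t. \<integral>\<^sup>+z. ennreal (?p z / fact N) * (ennreal (t ^ N * exp (- ((1 + sqnorm d z) * t))) * indicator {0..} t)
           \<partial>chart_leb d \<partial>lborel)"
    by (rule CL.Fubini'[symmetric]) measurable
  also have "\<dots> = (\<integral>\<^sup>+t. ennreal ?c * (ennreal (t ^ m * exp (- (1 * t))) * indicator {0..} t) \<partial>lborel)"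
  proof (rule nn_integral_cong_AE)
    \<comment> \<open>The Gaussian moments need t > 0; the single point t = 0 is discarded as a null
      set, and negative t fall outside the indicator.\<close>
    have "AE t in lborel. t \<noteq> (0::real)" by (rule AE_lborel_singleton)
    then show "AE t in lborel. (\<integral>\<^sup>+z. ennreal (?p z / fact N) * (ennreal (t ^ N * exp (- ((1 + sqnorm d z) * t))) * indicator {0..} t)
           \<partial>chart_leb d) = ennreal ?c * (ennreal (t ^ m * exp (- (1 * t))) * indicator {0..} t)"
    proof eventually_elim
      case (elim t)
      show ?case
      proof (cases "t > 0")
        case True
        let ?g = "\<lambda>i w. ennreal ((cmod w)\<^sup>2 ^ \<alpha> i * exp (- (t * (cmod w)\<^sup>2)))"
        have "ennreal (?p z / fact N) * (ennreal (t ^ N * exp (- ((1 + sqnorm d z) * t))) * indicator {0..} t)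
           = ennreal (t ^ N * exp (- t) / fact N) * (\<Prod>i<d. ?g i (z i))" for z
        proof -
          have "exp (- ((1 + sqnorm d z) * t)) = exp (- t) * (\<Prod>i<d. exp (- (t * (cmod (z i))\<^sup>2)))"
            by (subst exp_sum[symmetric], simp)
               (simp add: exp_add[symmetric] sqnorm_def sum_negf algebra_simps sum_distrib_left)
          then show ?thesis using True
            by (simp add: prod_ennreal ennreal_mult[symmetric] prod_nonneg prod.distrib)
        qed
        then have "(\<integral>\<^sup>+z. ennreal (?p z / fact N) * (ennreal (t ^ N * exp (- ((1 + sqnorm d z) * t))) * indicator {0..} t) \<partial>chart_leb d)
           = (\<integral>\<^sup>+z. ennreal (t ^ N * exp (- t) / fact N) * (\<Prod>i<d. ?g i (z i)) \<partial>chart_leb d)"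
          by (intro nn_integral_cong)
        also have "\<dots> = ennreal (t ^ N * exp (- t) / fact N) * (\<integral>\<^sup>+z. (\<Prod>i<d. ?g i (z i)) \<partial>chart_leb d)"
          by (rule nn_integral_cmult) measurable
        also have "(\<integral>\<^sup>+z. (\<Prod>i<d. ?g i (z i)) \<partial>chart_leb d) = (\<Prod>i<d. integral\<^sup>N lborel (?g i))"
          unfolding chart_leb_def by (rule P.product_nn_integral_prod) auto
        also have "\<dots> = (\<Prod>i<d. ennreal (pi * fact (\<alpha> i) / t ^ Suc (\<alpha> i)))"
          using True by (simp only: nn_integral_complex_gaussian_moment)
        also have "\<dots> = ennreal (\<Prod>i<d. pi * fact (\<alpha> i) / t ^ Suc (\<alpha> i))"
          using True by (intro prod_ennreal) simp
        also have "(\<Prod>i<d. pi * fact (\<alpha> i) / t ^ Suc (\<alpha> i)) = pi ^ d * (\<Prod>i<d. fact (\<alpha> i)) / t ^ (d + (\<Sum>i<d. \<alpha> i))"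
          by (simp add: prod_dividef prod.distrib power_add power_sum)
        \<comment> \<open>The moments contribute the power -(d + |\<alpha>|) of t, so exactly t^m is
          left of t^N; the last Gamma integral then supplies the factor m!.\<close>
        also have "ennreal (t ^ N * exp (- t) / fact N) * ennreal (pi ^ d * (\<Prod>i<d. fact (\<alpha> i)) / t ^ (d + (\<Sum>i<d. \<alpha> i)))
           = ennreal (?c * (t ^ m * exp (- t)))"
          using True by (subst ennreal_mult[symmetric])
            (auto simp: N_def power_add field_simps intro!: prod_nonneg mult_nonneg_nonneg)
        also have "\<dots> = ennreal ?c * (ennreal (t ^ m * exp (- (1 * t))) * indicator {0..} t)"
          using True by (subst ennreal_mult) (auto intro!: prod_nonneg mult_nonneg_nonneg divide_nonneg_nonneg)
        finally show ?thesis .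
      next
        case False
        with elim have "t < 0" by simp
        then show ?thesis by simp
      qed
    qed
  qed
  also have "\<dots> = ennreal ?c * (\<integral>\<^sup>+t. ennreal (t ^ m * exp (- (1 * t))) * indicator {0..} t \<partial>lborel)"
    by (rule nn_integral_cmult) measurable
  also have "\<dots> = ennreal ?c * ennreal (fact m / 1 ^ Suc m)"
    by (subst nn_integral_power_times_exp) auto
  also have "\<dots> = ennreal (pi ^ d * (\<Prod>i<d. fact (\<alpha> i)) * fact m / fact N)"
    by (subst ennreal_mult[symmetric]) (auto intro!: prod_nonneg mult_nonneg_nonneg divide_nonneg_nonneg)
  finally show ?thesis .
qed

section \<open>Coordinate rotations of the chart\<close>

lemma measurable_chart_leb_rotate:
  assumes k: "k < d"
  shows "(\<lambda>z. z(k := u * z k)) \<in> measurable (chart_leb d) (chart_leb d)"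
proof -
  have "(\<lambda>z. \<lambda>i\<in>{..<d}. if i = k then u * z k else z i) \<in> measurable (chart_leb d) (chart_leb d)"
    unfolding chart_leb_def using k by (intro measurable_restrict) auto
  moreover have "(\<lambda>i\<in>{..<d}. if i = k then u * z k else z i) = z(k := u * z k)"
    if "z \<in> space (chart_leb d)" for z
    using that k by (auto simp: chart_leb_def space_PiM PiE_def extensional_def restrict_def)
  ultimately show ?thesis by (subst measurable_cong) auto
qed

text \<open>The preimage of a rectangle is a rectangle in which only side k has been rotated, and
  planar area is rotation invariant. This torus symmetry is what separates monomials of different
  exponents.\<close>

lemma distr_chart_leb_rotate:
  assumes u: "cmod u = 1" "Re u \<noteq> -1" and k: "k < d"
  shows "distr (chart_leb d) (chart_leb d) (\<lambda>z. z(k := u * z k)) = chart_leb d"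
proof -
  interpret P: product_sigma_finite "\<lambda>_::nat. lborel :: complex measure"
    by (rule product_sigma_finite_lborel)
  note m = measurable_chart_leb_rotate[OF k]
  have "distr (chart_leb d) (chart_leb d) (\<lambda>z. z(k := u * z k)) = PiM {..<d} (\<lambda>_. lborel)"
  proof (rule P.PiM_eqI)
    fix A :: "nat \<Rightarrow> complex set"
    assume A: "\<And>i. i \<in> {..<d} \<Longrightarrow> A i \<in> sets lborel"
    then have Ak[measurable]: "A k \<in> sets borel" using k by simp
    let ?A = "A(k := (\<lambda>w. u * w) -` A k)"
    have A'k[measurable]: "(\<lambda>w. u * w) -` A k \<in> sets borel"
      by (rule measurable_sets_borel) measurable
    have e: "emeasure lborel ((\<lambda>w. u * w) -` A k) = emeasure lborel (A k)"
    proof -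
      have "emeasure lborel ((\<lambda>w. u * w) -` A k) = (\<integral>\<^sup>+z. indicator ((\<lambda>w. u * w) -` A k) z \<partial>lborel)"
        by (rule nn_integral_indicator[symmetric]) simp
      also have "\<dots> = (\<integral>\<^sup>+z. indicator (A k) (u * z) \<partial>lborel)"
        by (rule nn_integral_cong) (auto simp: indicator_def)
      also have "\<dots> = (\<integral>\<^sup>+z. indicator (A k) z \<partial>lborel)"
        by (rule nn_integral_rotate_complex) (use u in auto)
      finally show ?thesis by simp
    qed
    have "(\<lambda>z. z(k := u * z k)) -` (Pi\<^sub>E {..<d} A) \<inter> space (chart_leb d) = Pi\<^sub>E {..<d} ?A"
      using k by (auto simp: chart_leb_def space_PiM PiE_def extensional_def Pi_def split: if_splits)
    then have "emeasure (distr (chart_leb d) (chart_leb d) (\<lambda>z. z(k := u * z k))) (Pi\<^sub>E {..<d} A)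
       = emeasure (chart_leb d) (Pi\<^sub>E {..<d} ?A)"
      using m A by (subst emeasure_distr) (auto simp: chart_leb_def intro!: sets_PiM_I_finite)
    also have "\<dots> = (\<Prod>i<d. emeasure lborel (?A i))"
      unfolding chart_leb_def by (rule P.emeasure_PiM) (use A A'k in auto)
    also have "\<dots> = (\<Prod>i<d. emeasure lborel (A i))" using e by (intro prod.cong) auto
    finally show "emeasure (distr (chart_leb d) (chart_leb d) (\<lambda>z. z(k := u * z k))) (Pi\<^sub>E {..<d} A)
       = (\<Prod>i<d. emeasure lborel (A i))" .
  qed (auto simp: chart_leb_def)
  then show ?thesis by (simp add: chart_leb_def)
qed

text \<open>The weight depends on the moduli of the coordinates only, so a weighted monomial is an
  eigenfunction of each coordinate rotation.\<close>

lemma mono_fn_rotate: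
  assumes "cmod u = 1" "k < d"
  shows "mono_fn d L \<alpha> (z(k := u * z k)) = u ^ \<alpha> k * mono_fn d L \<alpha> z"
proof -
  have "sqnorm d (z(k := u * z k)) = sqnorm d z"
    unfolding sqnorm_def using assms by (intro sum.cong) (auto simp: norm_mult)
  moreover have "(\<Prod>i<d. (z(k := u * z k)) i ^ \<alpha> i) = u ^ \<alpha> k * (\<Prod>i<d. z i ^ \<alpha> i)"
    using assms by (subst (1 2) prod.remove[of _ k]) (auto simp: power_mult_distrib intro!: prod.cong)
  ultimately show ?thesis by (simp add: mono_fn_def)
qed

text \<open>Squaring clears the half-integer exponent and leaves the power d + L + 1, which matches
  the chart integral with m = L - |\<alpha>|.\<close>

lemma cmod_mono_fn_sq:
  "(cmod (mono_fn d L \<alpha> z))\<^sup>2 = (\<Prod>i<d. (cmod (z i))\<^sup>2 ^ \<alpha> i) / (1 + sqnorm d z) ^ Suc (d + L)"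
proof -
  have "((1 + sqnorm d z) powr (- (real d + real L + 1) / 2))\<^sup>2 = (1 + sqnorm d z) powr (- real (Suc (d + L)))"
    by (simp add: power2_eq_square powr_add[symmetric] add_ac)
  also have "\<dots> = 1 / (1 + sqnorm d z) ^ Suc (d + L)"
    by (simp only: powr_minus_divide powr_realpow sqnorm_pos)
  finally show ?thesis
    by (simp add: mono_fn_def norm_mult prod_norm[symmetric] norm_power power_mult_distrib prod_power_distrib
        power_mult[symmetric] mult.commute)
qed

lemma exists_rotation_separating_powers:
  assumes "a \<noteq> (b::nat)"
  obtains u where "cmod u = 1" "Re u \<noteq> -1" "u ^ a * cnj (u ^ b) \<noteq> 1"
proof -
  define n where "n = real a - real b"
  \<comment> \<open>The angle is chosen so that u^(a-b) is i or -i, hence not 1. Since |n| \<ge> 1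
    it is at most pi/2, which keeps u away from -1, where the shear decomposition fails.\<close>
  define u where "u = cis (pi / (2 * \<bar>n\<bar>))"
  have n: "\<bar>n\<bar> \<ge> 1" using assms by (auto simp: n_def)
  have "cos (pi / (2 * \<bar>n\<bar>)) \<ge> 0"
  proof (rule cos_ge_zero)
    show "pi / (2 * \<bar>n\<bar>) \<le> pi / 2" using n by (simp add: field_simps)
    have "0 \<le> pi / (2 * \<bar>n\<bar>)" by simp
    then show "- (pi / 2) \<le> pi / (2 * \<bar>n\<bar>)" using pi_ge_zero by linarith
  qed
  then have 1: "Re u \<noteq> -1" by (simp add: u_def)
  have "u ^ a * cnj (u ^ b) = cis (n * (pi / (2 * \<bar>n\<bar>)))"
    by (simp add: u_def Complex.DeMoivre cis_cnj cis_mult n_def algebra_simps diff_divide_distrib)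
  also have "n * (pi / (2 * \<bar>n\<bar>)) = pi / 2 \<or> n * (pi / (2 * \<bar>n\<bar>)) = - (pi / 2)"
  proof (cases "n > 0")
    case True
    then show ?thesis by simp
  next
    case False
    with n have "\<bar>n\<bar> = - n" "n \<noteq> 0" by auto
    then show ?thesis by simp
  qed
  then have "cis (n * (pi / (2 * \<bar>n\<bar>))) \<noteq> 1"
    by (elim disjE) (simp_all only: complex_eq_iff cis.sel cos_minus cos_pi_half one_complex.sel, simp_all)
  finally show thesis using 1 that[of u] by (simp add: u_def)
qed

lemma midx_sum_le: "\<alpha> \<in> midx d L \<Longrightarrow> (\<Sum>i<d. \<alpha> i) \<le> L"
  by (simp add: midx_def)

text \<open>If the exponents differ at k, a rotation of coordinate k multiplies the integral by a
  number other than 1, so it vanishes. Invariance alone says nothing about integrability, which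
  comes from bounding the product by the sum of the squares. For equal exponents, |\<alpha>| \<le> L
  makes m = L - |\<alpha>| admissible in the chart integral, with total exponent N = d + L.\<close>

lemma has_bochner_integral_mono_fn:
  assumes \<alpha>: "\<alpha> \<in> midx d L" and \<beta>: "\<beta> \<in> midx d L"
  shows "has_bochner_integral (chart_leb d) (\<lambda>z. mono_fn d L \<alpha> z * cnj (mono_fn d L \<beta> z))
    (if \<alpha> = \<beta> then of_real (pi ^ d * (\<Prod>i<d. fact (\<alpha> i)) * fact (L - (\<Sum>i<d. \<alpha> i)) / fact (d + L)) else 0)"
proof -
  have sq: "has_bochner_integral (chart_leb d) (\<lambda>z. (cmod (mono_fn d L \<alpha> z))\<^sup>2)
     (pi ^ d * (\<Prod>i<d. fact (\<alpha> i)) * fact (L - (\<Sum>i<d. \<alpha> i)) / fact (d + L))"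
    if "\<alpha> \<in> midx d L" for \<alpha>
  proof (rule has_bochner_integral_nn_integral)
    show "(\<integral>\<^sup>+z. ennreal ((cmod (mono_fn d L \<alpha> z))\<^sup>2) \<partial>chart_leb d)
       = ennreal (pi ^ d * (\<Prod>i<d. fact (\<alpha> i)) * fact (L - (\<Sum>i<d. \<alpha> i)) / fact (d + L))"
      unfolding cmod_mono_fn_sq
      using nn_integral_chart_monomial[of d \<alpha> "L - (\<Sum>i<d. \<alpha> i)"] midx_sum_le[OF that] by simp
  qed (auto intro!: divide_nonneg_nonneg mult_nonneg_nonneg prod_nonneg)
  have int: "integrable (chart_leb d) (\<lambda>z. mono_fn d L \<alpha> z * cnj (mono_fn d L \<beta> z))"
  proof (rule Bochner_Integration.integrable_bound)
    show "integrable (chart_leb d) (\<lambda>z. (cmod (mono_fn d L \<alpha> z))\<^sup>2 + (cmod (mono_fn d L \<beta> z))\<^sup>2)"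
      using sq[OF \<alpha>] sq[OF \<beta>] by (auto simp: has_bochner_integral_iff)
    have "x * y \<le> x\<^sup>2 + y\<^sup>2" if "0 \<le> x" "0 \<le> y" for x y :: real
      using sum_squares_bound[of x y] mult_nonneg_nonneg[OF that] by (simp only: mult.assoc)
    then show "AE z in chart_leb d. norm (mono_fn d L \<alpha> z * cnj (mono_fn d L \<beta> z))
        \<le> norm ((cmod (mono_fn d L \<alpha> z))\<^sup>2 + (cmod (mono_fn d L \<beta> z))\<^sup>2)"
      by (auto simp: norm_mult)
  qed measurable
  show ?thesis
  proof (cases "\<alpha> = \<beta>")
    case True
    then show ?thesis
      using has_bochner_integral_of_real[OF sq[OF \<alpha>], where 'a = complex]
      by (simp only: complex_norm_square simp_thms if_True)
  next
    case False
    then obtain k where k: "k < d" "\<alpha> k \<noteq> \<beta> k"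
      using \<alpha> \<beta> unfolding midx_def fun_eq_iff by (metis (mono_tags, lifting) mem_Collect_eq not_less)
    obtain u where u: "cmod u = 1" "Re u \<noteq> -1" "u ^ \<alpha> k * cnj (u ^ \<beta> k) \<noteq> 1"
      using exists_rotation_separating_powers[OF k(2)] .
    let ?f = "\<lambda>z. mono_fn d L \<alpha> z * cnj (mono_fn d L \<beta> z)"
    have "integral\<^sup>L (chart_leb d) ?f = (\<integral>z. ?f (z(k := u * z k)) \<partial>chart_leb d)"
      by (subst distr_chart_leb_rotate[OF u(1,2) k(1), symmetric]) (rule integral_distr[OF measurable_chart_leb_rotate[OF k(1)]], measurable)
    also have "\<dots> = (\<integral>z. (u ^ \<alpha> k * cnj (u ^ \<beta> k)) * ?f z \<partial>chart_leb d)"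
      by (simp only: mono_fn_rotate[OF u(1) k(1)] complex_cnj_mult mult_ac)
    also have "\<dots> = (u ^ \<alpha> k * cnj (u ^ \<beta> k)) * integral\<^sup>L (chart_leb d) ?f"
      by (rule integral_mult_right_zero)
    finally have "integral\<^sup>L (chart_leb d) ?f = 0" using u(3) by simp
    then show ?thesis using int False by (simp add: has_bochner_integral_iff)
  qed
qed

section \<open>The projection kernel\<close>

lemma midx_0: "midx 0 L = {\<lambda>_. 0}"
  by (auto simp: midx_def)

lemma midx_Suc: "midx (Suc d) L = (\<lambda>(k,\<beta>). \<beta>(d := k)) ` Sigma {..L} (\<lambda>k. midx d (L - k))"
proof (intro equalityI subsetI)
  fix \<alpha> assume \<alpha>: "\<alpha> \<in> midx (Suc d) L"
  have "(\<Sum>i<d. (\<alpha>(d := 0)) i) = (\<Sum>i<d. \<alpha> i)" by (rule sum.cong) auto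
  then have "(\<alpha> d, \<alpha>(d := 0)) \<in> Sigma {..L} (\<lambda>k. midx d (L - k))"
    using \<alpha> by (auto simp: midx_def)
  moreover have "\<alpha> = (\<lambda>(k,\<beta>). \<beta>(d := k)) (\<alpha> d, \<alpha>(d := 0))" by simp
  ultimately show "\<alpha> \<in> (\<lambda>(k,\<beta>). \<beta>(d := k)) ` Sigma {..L} (\<lambda>k. midx d (L - k))" by blast
next
  fix \<alpha> assume "\<alpha> \<in> (\<lambda>(k,\<beta>). \<beta>(d := k)) ` Sigma {..L} (\<lambda>k. midx d (L - k))"
  then obtain k \<beta> where *: "k \<le> L" "\<beta> \<in> midx d (L - k)" "\<alpha> = \<beta>(d := k)" by auto
  have "(\<Sum>i<d. (\<beta>(d := k)) i) = (\<Sum>i<d. \<beta> i)" by (rule sum.cong) auto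
  with * show "\<alpha> \<in> midx (Suc d) L" by (auto simp: midx_def)
qed

text \<open>Elements of \<open>midx d\<close> vanish at index d, so the update there overwrites a
  known 0 and can be undone.\<close>

lemma inj_on_midx_Suc: "inj_on (\<lambda>(k,\<beta>). \<beta>(d := k)) (Sigma {..L} (\<lambda>k. midx d (L - k)))"
proof (rule inj_onI, clarify)
  fix k \<beta> k' \<beta>'
  assume "\<beta> \<in> midx d (L - k)" "\<beta>' \<in> midx d (L - k')" and eq: "\<beta>(d := k) = \<beta>'(d := k')"
  then have "\<beta> d = \<beta>' d" by (simp add: midx_def)
  with eq show "k = k' \<and> \<beta> = \<beta>'"
    by (metis fun_upd_same fun_upd_triv fun_upd_upd)
qed

lemma finite_midx [simp]: "finite (midx d L)"
  by (induction d arbitrary: L) (auto simp: midx_0 midx_Suc)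

text \<open>The multinomial theorem in d + 1 variables with the extra variable set to 1 and L -
  |\<alpha>| as its exponent; that variable is the homogeneous coordinate normalized by the chart.
  The induction on d peels off the last variable with the binomial theorem.\<close>

lemma sum_midx_multinomial:
  fixes x :: "nat \<Rightarrow> 'a::field_char_0"
  shows "(\<Sum>\<alpha>\<in>midx d L. (\<Prod>i<d. x i ^ \<alpha> i) / ((\<Prod>i<d. fact (\<alpha> i)) * fact (L - (\<Sum>i<d. \<alpha> i))))
       = (1 + (\<Sum>i<d. x i)) ^ L / fact L"
proof (induction d arbitrary: L)
  case 0
  then show ?case by (simp add: midx_0)
next
  case (Suc d)
  let ?t = "\<lambda>d L \<alpha>. (\<Prod>i<d. x i ^ \<alpha> i) / ((\<Prod>i<d. fact (\<alpha> i)) * fact (L - (\<Sum>i<d. \<alpha> i)))"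
  have "(\<Sum>\<alpha>\<in>midx (Suc d) L. ?t (Suc d) L \<alpha>)
      = (\<Sum>(k,\<beta>)\<in>Sigma {..L} (\<lambda>k. midx d (L - k)). ?t (Suc d) L (\<beta>(d := k)))"
    unfolding midx_Suc by (subst sum.reindex[OF inj_on_midx_Suc]) (auto intro!: sum.cong)
  also have "\<dots> = (\<Sum>k\<le>L. \<Sum>\<beta>\<in>midx d (L - k). ?t (Suc d) L (\<beta>(d := k)))"
    by (subst sum.Sigma) auto
  also have "\<dots> = (\<Sum>k\<le>L. \<Sum>\<beta>\<in>midx d (L - k). x d ^ k / fact k * ?t d (L - k) \<beta>)"
  proof (intro sum.cong refl)
    fix k \<beta>
    have "(\<Sum>i<d. (\<beta>(d := k)) i) = (\<Sum>i<d. \<beta> i)" "(\<Prod>i<d. x i ^ (\<beta>(d := k)) i) = (\<Prod>i<d. x i ^ \<beta> i)"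
      "(\<Prod>i<d. fact ((\<beta>(d := k)) i)) = (\<Prod>i<d. fact (\<beta> i) :: 'a)"
      by (rule sum.cong prod.cong; auto)+
    then show "?t (Suc d) L (\<beta>(d := k)) = x d ^ k / fact k * ?t d (L - k) \<beta>"
      by (simp add: add.commute mult_ac)
  qed
  also have "\<dots> = (\<Sum>k\<le>L. x d ^ k / fact k * ((1 + (\<Sum>i<d. x i)) ^ (L - k) / fact (L - k)))"
    by (simp only: sum_distrib_left[symmetric] Suc.IH)
  also have "\<dots> = (\<Sum>k\<le>L. of_nat (L choose k) * x d ^ k * (1 + (\<Sum>i<d. x i)) ^ (L - k)) / fact L"
    unfolding sum_divide_distrib by (intro sum.cong refl) (simp add: binomial_fact)
  also have "\<dots> = (1 + (\<Sum>i<Suc d. x i)) ^ L / fact L"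
    by (subst binomial_ring[symmetric]) (simp add: add_ac)
  finally show ?case .
qed

text \<open>Evaluating the inner product of \<open>e i\<close> with \<open>f j\<close> once through
  the expansion of \<open>f j\<close> and once through that of \<open>e i\<close> shows that the
  inverse change of basis is the adjoint one. One substitution then carries either kernel to the
  other, pointwise and not merely almost everywhere.\<close>

lemma kernel_orthonormal_bases_eq:
  fixes e :: "'i \<Rightarrow> 'a \<Rightarrow> complex" and f :: "'j \<Rightarrow> 'a \<Rightarrow> complex"
  assumes fin: "finite I" "finite J"
    and e: "\<And>i j. i \<in> I \<Longrightarrow> j \<in> I \<Longrightarrow> has_bochner_integral M (\<lambda>x. e i x * cnj (e j x)) (if i = j then 1 else 0)"
    and f: "\<And>i j. i \<in> J \<Longrightarrow> j \<in> J \<Longrightarrow> has_bochner_integral M (\<lambda>x. f i x * cnj (f j x)) (if i = j then 1 else 0)"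
    and fe: "\<And>j. j \<in> J \<Longrightarrow> \<exists>c. f j = (\<lambda>x. \<Sum>i\<in>I. c i * e i x)"
    and ef: "\<And>i. i \<in> I \<Longrightarrow> \<exists>c. e i = (\<lambda>x. \<Sum>j\<in>J. c j * f j x)"
  shows "(\<Sum>j\<in>J. f j x * cnj (f j y)) = (\<Sum>i\<in>I. e i x * cnj (e i y))"
proof -
  from fe obtain a where a: "\<And>j. j \<in> J \<Longrightarrow> f j = (\<lambda>x. \<Sum>i\<in>I. a j i * e i x)" by metis
  from ef obtain b where b: "\<And>i. i \<in> I \<Longrightarrow> e i = (\<lambda>x. \<Sum>j\<in>J. b i j * f j x)" by metis
  have ab: "b i j = cnj (a j i)" if "i \<in> I" "j \<in> J" for i j
  proof -
    have "has_bochner_integral M (\<lambda>x. \<Sum>i'\<in>I. cnj (a j i') * (e i x * cnj (e i' x)))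
        (\<Sum>i'\<in>I. cnj (a j i') * (if i = i' then 1 else 0))"
      by (intro has_bochner_integral_sum has_bochner_integral_mult_right e that)
    moreover have "(\<lambda>x. \<Sum>i'\<in>I. cnj (a j i') * (e i x * cnj (e i' x))) = (\<lambda>x. e i x * cnj (f j x))"
      using a[OF that(2)] by (simp add: sum_distrib_left mult_ac)
    moreover have "(\<Sum>i'\<in>I. cnj (a j i') * (if i = i' then 1 else 0)) = cnj (a j i)"
      using that fin by (simp add: if_distrib cong: if_cong)
    ultimately have 1: "has_bochner_integral M (\<lambda>x. e i x * cnj (f j x)) (cnj (a j i))" by simp
    have "has_bochner_integral M (\<lambda>x. \<Sum>j'\<in>J. b i j' * (f j' x * cnj (f j x)))
        (\<Sum>j'\<in>J. b i j' * (if j' = j then 1 else 0))"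
      by (intro has_bochner_integral_sum has_bochner_integral_mult_right f that)
    moreover have "(\<lambda>x. \<Sum>j'\<in>J. b i j' * (f j' x * cnj (f j x))) = (\<lambda>x. e i x * cnj (f j x))"
      by (subst b[OF that(1)]) (simp add: sum_distrib_right mult.assoc)
    moreover have "(\<Sum>j'\<in>J. b i j' * (if j' = j then 1 else 0)) = b i j"
      using that fin by (simp add: if_distrib cong: if_cong)
    ultimately have "has_bochner_integral M (\<lambda>x. e i x * cnj (f j x)) (b i j)" by simp
    with 1 show ?thesis by (rule has_bochner_integral_eq[OF _ , symmetric])
  qed
  have "(\<Sum>j\<in>J. f j x * cnj (f j y)) = (\<Sum>j\<in>J. \<Sum>i\<in>I. f j x * (cnj (a j i) * cnj (e i y)))"
    by (intro sum.cong refl) (subst (2) a, auto simp: sum_distrib_left)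
  also have "\<dots> = (\<Sum>i\<in>I. \<Sum>j\<in>J. f j x * (cnj (a j i) * cnj (e i y)))" by (rule sum.swap)
  also have "\<dots> = (\<Sum>i\<in>I. (\<Sum>j\<in>J. b i j * f j x) * cnj (e i y))"
    unfolding sum_distrib_right by (intro sum.cong refl) (simp add: ab mult_ac)
  also have "\<dots> = (\<Sum>i\<in>I. e i x * cnj (e i y))"
    by (intro sum.cong refl) (subst b, auto)
  finally show ?thesis .
qed

text \<open>The value of \<open>has_bochner_integral_mono_fn\<close> for equal exponents.\<close>

definition mono_norm_sq :: "nat \<Rightarrow> nat \<Rightarrow> (nat \<Rightarrow> nat) \<Rightarrow> real" where
  "mono_norm_sq d L \<alpha> = pi ^ d * (\<Prod>i<d. fact (\<alpha> i)) * fact (L - (\<Sum>i<d. \<alpha> i)) / fact (d + L)"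

lemma mono_norm_sq_pos [simp]: "mono_norm_sq d L \<alpha> > 0"
  by (auto simp: mono_norm_sq_def intro!: divide_pos_pos mult_pos_pos prod_pos)

text \<open>The constant is r d! / pi^d. The last factor combines the normalizations of (1,z) and
  (1,w), each to the power -L, with the square roots of the two volume densities, which appear
  because the kernel is taken with respect to Lebesgue measure on the chart.\<close>

definition proj_kernel :: "nat \<Rightarrow> nat \<Rightarrow> cpt \<Rightarrow> cpt \<Rightarrow> complex" where
  "proj_kernel d L z w = of_real (fact (d + L) / (pi ^ d * fact L)) * (1 + cinner d z w) ^ L
      * of_real (((1 + sqnorm d z) * (1 + sqnorm d w)) powr (- (real d + real L + 1) / 2))"

text \<open>The factorials in the norms of the monomials are those of the multinomial theorem for x
  i = z i * cnj (w i), so the sum closes up.\<close>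

lemma sum_mono_fn_kernel:
  "(\<Sum>\<alpha>\<in>midx d L. mono_fn d L \<alpha> z * cnj (mono_fn d L \<alpha> w) / mono_norm_sq d L \<alpha>)
   = proj_kernel d L z w"
proof -
  let ?W = "complex_of_real (((1 + sqnorm d z) * (1 + sqnorm d w)) powr (- (real d + real L + 1) / 2))"
  let ?C = "fact (d + L) / of_real pi ^ d * ?W"
  have "(\<Sum>\<alpha>\<in>midx d L. mono_fn d L \<alpha> z * cnj (mono_fn d L \<alpha> w) / mono_norm_sq d L \<alpha>)
    = (\<Sum>\<alpha>\<in>midx d L. ?C * ((\<Prod>i<d. (z i * cnj (w i)) ^ \<alpha> i) / ((\<Prod>i<d. fact (\<alpha> i)) * fact (L - (\<Sum>i<d. \<alpha> i)))))"
    by (intro sum.cong refl)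
       (simp add: mono_fn_def mono_norm_sq_def power_mult_distrib prod.distrib powr_mult mult_ac)
  also have "\<dots> = ?C * ((1 + cinner d z w) ^ L / fact L)"
    unfolding sum_distrib_left[symmetric] sum_midx_multinomial cinner_def ..
  finally show ?thesis by (simp add: proj_kernel_def mult_ac)
qed

lemma is_onb_has_bochner_integral:
  assumes "is_onb d L \<phi>" "i < rL d L" "j < rL d L"
  shows "has_bochner_integral (chart_leb d) (\<lambda>z. \<phi> i z * cnj (\<phi> j z)) (if i = j then 1 else 0)"
  using assms by (simp add: is_onb_def has_bochner_integral_iff)

text \<open>The normalized monomials \<open>e\<close> form an orthonormal system with the same span
  as \<phi>, so the two kernels agree.\<close>

lemma is_onb_kern:
  assumes "is_onb d L \<phi>"
  shows "kern (rL d L) \<phi> z w = proj_kernel d L z w"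
proof -
  define e where "e \<alpha> z = mono_fn d L \<alpha> z / complex_of_real (sqrt (mono_norm_sq d L \<alpha>))" for \<alpha> z
  have sq: "complex_of_real (sqrt (mono_norm_sq d L \<alpha>)) * complex_of_real (sqrt (mono_norm_sq d L \<alpha>))
      = complex_of_real (mono_norm_sq d L \<alpha>)" for \<alpha>
    by (metis abs_of_pos mono_norm_sq_pos of_real_mult real_sqrt_mult_self)
  have nz: "complex_of_real (sqrt (mono_norm_sq d L \<alpha>)) \<noteq> 0" for \<alpha>
    using mono_norm_sq_pos[of d L \<alpha>] by (simp del: mono_norm_sq_pos)
  have "kern (rL d L) \<phi> z w = (\<Sum>i\<in>{..<rL d L}. \<phi> i z * cnj (\<phi> i w))" by (simp add: kern_def)
  also have "\<dots> = (\<Sum>\<alpha>\<in>midx d L. e \<alpha> z * cnj (e \<alpha> w))"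
  proof (rule kernel_orthonormal_bases_eq[where M = "chart_leb d"])
    fix \<alpha> \<beta> assume "\<alpha> \<in> midx d L" "\<beta> \<in> midx d L"
    from has_bochner_integral_divide_zero[OF has_bochner_integral_mono_fn[OF this], of
        "complex_of_real (sqrt (mono_norm_sq d L \<alpha>)) * complex_of_real (sqrt (mono_norm_sq d L \<beta>))"]
    show "has_bochner_integral (chart_leb d) (\<lambda>x. e \<alpha> x * cnj (e \<beta> x)) (if \<alpha> = \<beta> then 1 else 0)"
      unfolding mono_norm_sq_def[symmetric] e_def
      using sq[of \<alpha>] mono_norm_sq_pos[of d L \<alpha>] by (auto simp del: mono_norm_sq_pos)
  next
    fix i assume "i \<in> {..<rL d L}"
    then obtain c where "\<phi> i = (\<lambda>z. \<Sum>\<alpha>\<in>midx d L. c \<alpha> * mono_fn d L \<alpha> z)"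
      using assms by (auto simp: is_onb_def H_dL_def)
    then have "\<phi> i = (\<lambda>z. \<Sum>\<alpha>\<in>midx d L. (c \<alpha> * complex_of_real (sqrt (mono_norm_sq d L \<alpha>))) * e \<alpha> z)"
      using nz by (simp add: e_def)
    then show "\<exists>c. \<phi> i = (\<lambda>z. \<Sum>\<alpha>\<in>midx d L. c \<alpha> * e \<alpha> z)"
      by (rule exI[where x = "\<lambda>\<alpha>. c \<alpha> * complex_of_real (sqrt (mono_norm_sq d L \<alpha>))"])
  next
    fix \<alpha> assume \<alpha>: "\<alpha> \<in> midx d L"
    have "e \<alpha> = (\<lambda>z. \<Sum>\<beta>\<in>midx d L. (if \<beta> = \<alpha> then 1 / complex_of_real (sqrt (mono_norm_sq d L \<alpha>)) else 0) * mono_fn d L \<beta> z)"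
      using \<alpha> by (intro ext) (simp add: e_def if_distrib[of "\<lambda>x. x * _"] cong: if_cong)
    then have "e \<alpha> \<in> H_dL d L"
      unfolding H_dL_def mem_Collect_eq
      by (rule exI[where x = "\<lambda>\<beta>. if \<beta> = \<alpha> then 1 / complex_of_real (sqrt (mono_norm_sq d L \<alpha>)) else 0"])
    then show "\<exists>c. e \<alpha> = (\<lambda>z. \<Sum>j\<in>{..<rL d L}. c j * \<phi> j z)"
      using assms by (auto simp: is_onb_def)
  next
    show "has_bochner_integral (chart_leb d) (\<lambda>x. \<phi> i x * cnj (\<phi> j x)) (if i = j then 1 else 0)"
      if "i \<in> {..<rL d L}" "j \<in> {..<rL d L}" for i j
      using is_onb_has_bochner_integral[OF assms] that by simp
  qed auto
  also have "\<dots> = (\<Sum>\<alpha>\<in>midx d L. mono_fn d L \<alpha> z * cnj (mono_fn d L \<alpha> w) / mono_norm_sq d L \<alpha>)"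
    using sq by (simp add: e_def)
  finally show ?thesis unfolding sum_mono_fn_kernel .
qed

section \<open>Integrals over projective space\<close>

text \<open>The squared cosine of the Fubini--Study distance between the lines through (1,z) and
  (1,w), written in chart coordinates; \<open>sin_dP_psi\<close> gives the link.\<close>

definition cos_sq :: "nat \<Rightarrow> cpt \<Rightarrow> cpt \<Rightarrow> real" where
  "cos_sq d z w = (cmod (1 + cinner d z w))\<^sup>2 / ((1 + sqnorm d z) * (1 + sqnorm d w))"

lemma cinner_psi: "cinner (d + 1) (psi z) (psi w) = 1 + cinner d z w"
  unfolding cinner_def Suc_eq_plus1[symmetric] by (subst sum.lessThan_Suc_shift) (simp add: psi_def)

lemma sqnorm_psi: "sqnorm (d + 1) (psi z) = 1 + sqnorm d z"
  unfolding sqnorm_def Suc_eq_plus1[symmetric] by (subst sum.lessThan_Suc_shift) (simp add: psi_def)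

lemma cmod_cinner_sq_le: "(cmod (cinner n p q))\<^sup>2 \<le> sqnorm n p * sqnorm n q"
proof -
  have "cmod (cinner n p q) \<le> (\<Sum>i<n. cmod (p i) * cmod (q i))"
    unfolding cinner_def by (rule order.trans[OF norm_sum]) (simp add: norm_mult)
  then have "(cmod (cinner n p q))\<^sup>2 \<le> (\<Sum>i<n. cmod (p i) * cmod (q i))\<^sup>2"
    by (rule power_mono) simp
  also have "\<dots> \<le> sqnorm n p * sqnorm n q"
    unfolding sqnorm_def by (rule Cauchy_Schwarz_ineq_sum)
  finally show ?thesis .
qed

lemma cos_sq_nonneg [simp]: "0 \<le> cos_sq d z w"
  by (simp add: cos_sq_def less_imp_le)

lemma cos_sq_le_1: "cos_sq d z w \<le> 1"
  using cmod_cinner_sq_le[of "d + 1" "psi z" "psi w"] unfolding cinner_psi sqnorm_psi cos_sq_def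
  by (simp add: divide_le_eq_1 mult_pos_pos)

lemma sin_dP_psi: "sin_dP d (psi z) (psi w) = sqrt (1 - cos_sq d z w)"
  by (simp add: sin_dP_def cinner_psi[simplified] sqnorm_psi[simplified] cos_sq_def)

lemma cinner_measurable [measurable]:
  "(\<lambda>(z,w). cinner d z w) \<in> borel_measurable (PiM {..<d} (\<lambda>_. borel) \<Otimes>\<^sub>M PiM {..<d} (\<lambda>_. borel))"
  unfolding cinner_def by measurable

lemma cos_sq_measurable [measurable]:
  "(\<lambda>(z,w). cos_sq d z w) \<in> borel_measurable (PiM {..<d} (\<lambda>_. borel) \<Otimes>\<^sub>M PiM {..<d} (\<lambda>_. borel))"
  unfolding cos_sq_def by measurable

lemma cos_sq_measurable_snd [measurable]:
  "(\<lambda>w. cos_sq d z w) \<in> borel_measurable (PiM {..<d} (\<lambda>_. borel))"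
  unfolding cos_sq_def cinner_def by measurable

lemma sets_fs_vol [measurable_cong]: "sets (fs_vol d) = sets (PiM {..<d} (\<lambda>_. borel))"
  by (simp add: fs_vol_def sets_chart_leb)

definition fs_weight :: "nat \<Rightarrow> cpt \<Rightarrow> real" where
  "fs_weight d z = (1 + sqnorm d z) powr (- (real d + 1))"

lemma fs_weight_nonneg [simp]: "0 \<le> fs_weight d z"
  by (simp add: fs_weight_def)

lemma fs_weight_measurable [measurable]: "fs_weight d \<in> borel_measurable (PiM {..<d} (\<lambda>_. borel))"
  unfolding fs_weight_def by measurable

lemma nn_integral_fs_vol:
  assumes [measurable]: "f \<in> borel_measurable (PiM {..<d} (\<lambda>_. borel))"
  shows "(\<integral>\<^sup>+z. f z \<partial>fs_vol d) = (\<integral>\<^sup>+z. ennreal (fs_weight d z) * f z \<partial>chart_leb d)"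
  unfolding fs_vol_def fs_weight_def[symmetric] by (rule nn_integral_density) measurable

text \<open>The exponent -(d+m+1) splits into -(d+1), the volume density at each point, and -m,
  which normalizes the inner product to the m-th power of \<open>cos_sq\<close>. The degree m is
  free: m = L serves the ensemble, and all m together give the moments.\<close>

lemma cmod_proj_kernel_sq:
  "(cmod (proj_kernel d m z w))\<^sup>2
   = (fact (d + m) / (pi ^ d * fact m))\<^sup>2 * fs_weight d z * (fs_weight d w * cos_sq d z w ^ m)"
proof -
  let ?s = "(1 + sqnorm d z) * (1 + sqnorm d w)"
  have s: "?s > 0" by (simp add: mult_pos_pos)
  have "(?s powr (- (real d + real m + 1) / 2))\<^sup>2 = ?s powr (- (real d + 1) - real m)"
    by (simp add: power2_eq_square powr_add[symmetric] diff_divide_distrib add_divide_distrib algebra_simps)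
  also have "\<dots> = fs_weight d z * fs_weight d w / ?s ^ m"
    using s by (subst powr_diff) (simp add: powr_realpow powr_mult power_mult_distrib fs_weight_def)
  finally show ?thesis
    unfolding proj_kernel_def norm_mult power_mult_distrib norm_power
    by (simp add: cos_sq_def norm_divide norm_mult norm_power power_divide power_mult[symmetric] power_mult_distrib mult_ac)
qed

text \<open>On the diagonal the inner product cancels the degree-dependent part of the weight, so
  the first intensity is constant with respect to the Fubini--Study volume.\<close>

lemma proj_kernel_diag:
  "proj_kernel d m z z = of_real (fact (d + m) / (pi ^ d * fact m) * fs_weight d z)"
proof -
  define C :: real where "C = fact (d + m) / (pi ^ d * fact m)"
  have cz: "1 + cinner d z z = of_real (1 + sqnorm d z)"
    by (simp add: cinner_def sqnorm_def complex_norm_square[symmetric])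
  have "proj_kernel d m z z
     = of_real (C * ((1 + sqnorm d z) ^ m * ((1 + sqnorm d z) * (1 + sqnorm d z)) powr (- (real d + real m + 1) / 2)))"
    unfolding proj_kernel_def cz by (simp add: C_def)
  also have "((1 + sqnorm d z) * (1 + sqnorm d z)) powr (- (real d + real m + 1) / 2) = (1 + sqnorm d z) powr (- (real d + 1) - real m)"
  proof -
    have "((1 + sqnorm d z) * (1 + sqnorm d z)) powr x = (1 + sqnorm d z) powr (x + x)" for x
      by (simp only: powr_add) (simp add: powr_mult)
    moreover have "- (real d + real m + 1) / 2 + - (real d + real m + 1) / 2 = - (real d + 1) - real m"
      by (simp add: field_simps)
    ultimately show ?thesis by (simp only:)
  qed
  also have "(1 + sqnorm d z) ^ m * (1 + sqnorm d z) powr (- (real d + 1) - real m) = fs_weight d z"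
    using sqnorm_pos[of d z] by (subst powr_diff) (simp add: powr_realpow fs_weight_def)
  finally show ?thesis unfolding C_def .
qed

text \<open>By orthogonality of the monomials the kernel of the degree \<open>m\<close> ensemble is reproducing, so
  the \<open>m\<close>-th moment of \<open>cos\<^sup>2\<close> does not depend on the base point; no unitary invariance of the
  Fubini--Study volume is needed.\<close>

lemma nn_integral_cos_sq_power:
  "(\<integral>\<^sup>+w. ennreal (cos_sq d z w ^ m) \<partial>fs_vol d) = ennreal (pi ^ d * fact m / fact (d + m))"
proof -
  define C :: real where "C = fact (d + m) / (pi ^ d * fact m)"
  have C: "C > 0" by (simp add: C_def)
  define K where "K = (\<lambda>z w. \<Sum>\<alpha>\<in>midx d m. mono_fn d m \<alpha> z * cnj (mono_fn d m \<alpha> w) / mono_norm_sq d m \<alpha>)"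
  let ?A = "midx d m"
  let ?n = "mono_norm_sq d m"
  have Ksq: "(cmod (K z w))\<^sup>2 = C\<^sup>2 * fs_weight d z * (fs_weight d w * cos_sq d z w ^ m)" for w
    unfolding K_def C_def sum_mono_fn_kernel by (rule cmod_proj_kernel_sq)
  have Kzz: "(\<Sum>\<alpha>\<in>?A. mono_fn d m \<alpha> z * cnj (mono_fn d m \<alpha> z) / ?n \<alpha>) = of_real (C * fs_weight d z)"
    unfolding C_def sum_mono_fn_kernel by (rule proj_kernel_diag)
  \<comment> \<open>This is the identity that the integral of |K(z,w)|^2 over w equals K(z,z). The
    left side is C^2 \<open>fs_weight d z\<close> times the desired moment, the right side is C
    \<open>fs_weight d z\<close>, so the moment is 1/C.\<close>
  have "has_bochner_integral (chart_leb d)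
      (\<lambda>w. \<Sum>\<alpha>\<in>?A. \<Sum>\<beta>\<in>?A. (mono_fn d m \<beta> z * cnj (mono_fn d m \<alpha> z) / (of_real (?n \<alpha>) * of_real (?n \<beta>)))
           * (mono_fn d m \<alpha> w * cnj (mono_fn d m \<beta> w)))
      (\<Sum>\<alpha>\<in>?A. \<Sum>\<beta>\<in>?A. (mono_fn d m \<beta> z * cnj (mono_fn d m \<alpha> z) / (of_real (?n \<alpha>) * of_real (?n \<beta>)))
           * (if \<alpha> = \<beta> then of_real (?n \<alpha>) else 0))"
    unfolding mono_norm_sq_def
    by (intro has_bochner_integral_sum has_bochner_integral_mult_right has_bochner_integral_mono_fn)
  also have "(\<lambda>w. \<Sum>\<alpha>\<in>?A. \<Sum>\<beta>\<in>?A. (mono_fn d m \<beta> z * cnj (mono_fn d m \<alpha> z) / (of_real (?n \<alpha>) * of_real (?n \<beta>)))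
           * (mono_fn d m \<alpha> w * cnj (mono_fn d m \<beta> w))) = (\<lambda>w. of_real ((cmod (K z w))\<^sup>2))"
    unfolding complex_norm_square
    unfolding K_def cnj_sum sum_product
    by (intro ext, subst sum.swap) (intro sum.cong refl, simp add: mult_ac)
  also have "(\<Sum>\<alpha>\<in>?A. \<Sum>\<beta>\<in>?A. (mono_fn d m \<beta> z * cnj (mono_fn d m \<alpha> z) / (of_real (?n \<alpha>) * of_real (?n \<beta>)))
           * (if \<alpha> = \<beta> then of_real (?n \<alpha>) else 0)) = (\<Sum>\<alpha>\<in>?A. mono_fn d m \<alpha> z * cnj (mono_fn d m \<alpha> z) / ?n \<alpha>)"
    by (intro sum.cong refl) (simp add: if_distrib[of "\<lambda>x. _ * x"] less_imp_neq[OF mono_norm_sq_pos, symmetric] cong: if_cong)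
  also note Kzz
  finally have "has_bochner_integral (chart_leb d) (\<lambda>w. (cmod (K z w))\<^sup>2) (C * fs_weight d z)"
    using has_bochner_integral_bounded_linear[OF bounded_linear_Re] by fastforce
  then have "(\<integral>\<^sup>+w. ennreal ((cmod (K z w))\<^sup>2) \<partial>chart_leb d) = ennreal (C * fs_weight d z)"
    by (simp add: has_bochner_integral_iff nn_integral_eq_integral)
  moreover have "(\<integral>\<^sup>+w. ennreal ((cmod (K z w))\<^sup>2) \<partial>chart_leb d)
     = ennreal (C\<^sup>2 * fs_weight d z) * (\<integral>\<^sup>+w. ennreal (cos_sq d z w ^ m) \<partial>fs_vol d)"
    unfolding Ksq by (subst nn_integral_fs_vol, measurable) (subst nn_integral_cmult[symmetric], measurable,
        simp add: ennreal_mult[symmetric] mult_ac)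
  ultimately have eq: "ennreal (C\<^sup>2 * fs_weight d z) * (\<integral>\<^sup>+w. ennreal (cos_sq d z w ^ m) \<partial>fs_vol d) = ennreal (C * fs_weight d z)"
    by simp
  have w: "fs_weight d z > 0" using sqnorm_pos[of d z] by (simp add: fs_weight_def del: sqnorm_pos)
  have "(\<integral>\<^sup>+w. ennreal (cos_sq d z w ^ m) \<partial>fs_vol d)
     = ennreal (1 / (C\<^sup>2 * fs_weight d z)) * (ennreal (C\<^sup>2 * fs_weight d z) * (\<integral>\<^sup>+w. ennreal (cos_sq d z w ^ m) \<partial>fs_vol d))"
    using C w by (simp add: mult.assoc[symmetric] ennreal_mult[symmetric])
  also have "\<dots> = ennreal (1 / C)"
    unfolding eq using C w by (subst ennreal_mult[symmetric]) (auto simp: power2_eq_square)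
  finally show ?thesis by (simp add: C_def)
qed

lemma emeasure_fs_vol: "emeasure (fs_vol d) (space (fs_vol d)) = ennreal (pi ^ d / fact d)"
  using nn_integral_cos_sq_power[of d "\<lambda>_. 0" 0] by simp

text \<open>The measure of the set where \<open>cos_sq\<close> is 1 is bounded by every moment, and
  for d \<ge> 1 the moments decay at least like 1/m.\<close>

lemma AE_cos_sq_less_1:
  assumes "d \<ge> 1"
  shows "AE w in fs_vol d. cos_sq d z w < 1"
proof -
  let ?S = "{w \<in> space (fs_vol d). cos_sq d z w = 1}"
  have S[measurable]: "?S \<in> sets (fs_vol d)" by measurable
  have "emeasure (fs_vol d) ?S \<le> ennreal (pi ^ d / real (m + 1))" for m
  proof -
    have "emeasure (fs_vol d) ?S = (\<integral>\<^sup>+w. indicator ?S w \<partial>fs_vol d)" by simp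
    also have "\<dots> \<le> (\<integral>\<^sup>+w. ennreal (cos_sq d z w ^ m) \<partial>fs_vol d)"
      by (intro nn_integral_mono) (auto simp: indicator_def)
    also have "\<dots> = ennreal (pi ^ d * fact m / fact (d + m))" by (rule nn_integral_cos_sq_power)
    also have "\<dots> \<le> ennreal (pi ^ d / real (m + 1))"
    proof (rule ennreal_leI)
      have "fact (m + 1) \<le> (fact (d + m) :: real)" using assms by (intro fact_mono) auto
      then have "pi ^ d * (real (m + 1) * fact m) \<le> pi ^ d * fact (d + m)"
        by (intro mult_left_mono) (simp_all add: algebra_simps)
      then show "pi ^ d * fact m / fact (d + m) \<le> pi ^ d / real (m + 1)"
        by (simp add: field_simps)
    qed
    finally show ?thesis .
  qed
  moreover have "(\<lambda>m. ennreal (pi ^ d / real (m + 1))) \<longlonglongrightarrow> ennreal 0"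
    by (intro tendsto_ennrealI) real_asymp
  ultimately have "emeasure (fs_vol d) ?S \<le> ennreal 0"
    by (intro LIMSEQ_le_const[where X = "\<lambda>m. ennreal (pi ^ d / real (m + 1))"]) auto
  then have "emeasure (fs_vol d) ?S = 0" by simp
  then have "AE w in fs_vol d. w \<notin> ?S" by (intro AE_not_in) auto
  then show ?thesis
    by (rule AE_mp) (use cos_sq_le_1 in \<open>auto simp: less_le intro!: AE_I2\<close>)
qed

section \<open>Negative binomial series and Beta integrals\<close>

text \<open>The coefficients of (1 - x)^(-a). The rising factorial makes their nonnegativity
  visible, which the alternating form \<open>(- a) gchoose m\<close> hides.\<close>

definition neg_binom_coeff :: "real \<Rightarrow> nat \<Rightarrow> real" where
  "neg_binom_coeff a m = pochhammer a m / fact m"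

lemma neg_binom_coeff_nonneg: "0 \<le> a \<Longrightarrow> 0 \<le> neg_binom_coeff a m"
  by (auto simp: neg_binom_coeff_def pochhammer_prod intro!: divide_nonneg_pos prod_nonneg)

lemma neg_binom_sums:
  fixes c a :: real
  assumes "0 \<le> c" "c < 1"
  shows "(\<lambda>m. neg_binom_coeff a m * c ^ m) sums (1 - c) powr (- a)"
proof -
  have "(\<lambda>m. ((- a) gchoose m) * (- c) ^ m) sums (1 + (- c)) powr (- a)"
    by (rule gen_binomial_real) (use assms in auto)
  also have "(\<lambda>m. ((- a) gchoose m) * (- c) ^ m) = (\<lambda>m. neg_binom_coeff a m * c ^ m)"
    by (auto simp: gbinomial_pochhammer neg_binom_coeff_def fun_eq_iff power_mult_distrib[symmetric])
  finally show ?thesis by simp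
qed

lemma nn_integral_Beta:
  fixes a b :: real
  assumes "a > 0" "b > 0"
  shows "(\<integral>\<^sup>+t. ennreal (t powr (a - 1) * (1 - t) powr (b - 1)) * indicator {0<..<1} t \<partial>lborel) = ennreal (Beta a b)"
proof -
  have "((\<lambda>t. t powr (a - 1) * (1 - t) powr (b - 1)) has_integral Beta a b) {0<..<1}"
    using has_integral_Beta_real[OF assms] by (simp add: has_integral_Icc_iff_Ioo)
  then have "((\<lambda>t. if t \<in> {0<..<1} then t powr (a - 1) * (1 - t) powr (b - 1) else 0) has_integral Beta a b) UNIV"
    by (simp only: has_integral_restrict_UNIV)
  then have "(\<integral>\<^sup>+t. ennreal (if t \<in> {0<..<1} then t powr (a - 1) * (1 - t) powr (b - 1) else 0) \<partial>lborel) = ennreal (Beta a b)"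
    by (intro nn_integral_has_integral_lborel) auto
  also have "(\<integral>\<^sup>+t. ennreal (if t \<in> {0<..<1} then t powr (a - 1) * (1 - t) powr (b - 1) else 0) \<partial>lborel)
     = (\<integral>\<^sup>+t. ennreal (t powr (a - 1) * (1 - t) powr (b - 1)) * indicator {0<..<1} t \<partial>lborel)"
    by (intro nn_integral_cong) (auto simp: indicator_def)
  finally show ?thesis .
qed

text \<open>Beta(a, b+m) is the m-th moment of 1 - t under t^(a-1) (1-t)^(b-1) dt. Summing under the
  integral inserts (1 - (1-t))^(-c) = t^(-c), which lowers the first argument by c; c < a keeps it
  positive.\<close>

lemma suminf_neg_binom_Beta:
  fixes a b c :: real
  assumes "0 \<le> c" "c < a" "b > 0"
  shows "(\<Sum>m. ennreal (neg_binom_coeff c m * Beta a (b + real m))) = ennreal (Beta (a - c) b)"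
proof -
  have "(\<Sum>m. ennreal (neg_binom_coeff c m * Beta a (b + real m)))
    = (\<Sum>m. \<integral>\<^sup>+t. ennreal (neg_binom_coeff c m) * (ennreal (t powr (a - 1) * (1 - t) powr (b + real m - 1)) * indicator {0<..<1} t) \<partial>lborel)"
    using assms by (intro suminf_cong, subst nn_integral_cmult, measurable)
      (subst nn_integral_Beta, auto simp: ennreal_mult' neg_binom_coeff_nonneg)
  also have "\<dots> = (\<integral>\<^sup>+t. (\<Sum>m. ennreal (neg_binom_coeff c m) * (ennreal (t powr (a - 1) * (1 - t) powr (b + real m - 1)) * indicator {0<..<1} t)) \<partial>lborel)"
    by (rule nn_integral_suminf[symmetric]) measurable
  also have "\<dots> = (\<integral>\<^sup>+t. ennreal (t powr (a - c - 1) * (1 - t) powr (b - 1)) * indicator {0<..<1} t \<partial>lborel)"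
  proof (rule nn_integral_cong)
    fix t :: real
    show "(\<Sum>m. ennreal (neg_binom_coeff c m) * (ennreal (t powr (a - 1) * (1 - t) powr (b + real m - 1)) * indicator {0<..<1} t))
       = ennreal (t powr (a - c - 1) * (1 - t) powr (b - 1)) * indicator {0<..<1} t"
    proof (cases "t \<in> {0<..<1}")
      case True
      have "(\<lambda>m. t powr (a - 1) * (1 - t) powr (b - 1) * (neg_binom_coeff c m * (1 - t) ^ m)) sums
         (t powr (a - 1) * (1 - t) powr (b - 1) * (1 - (1 - t)) powr (- c))"
        by (intro sums_mult neg_binom_sums) (use True in auto)
      also have "t powr (a - 1) * (1 - t) powr (b - 1) * (1 - (1 - t)) powr (- c) = t powr (a - c - 1) * (1 - t) powr (b - 1)"
        using True by (simp add: powr_add[symmetric] mult_ac) (simp add: powr_diff powr_minus field_simps powr_add)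
      finally have "(\<Sum>m. ennreal (t powr (a - 1) * (1 - t) powr (b - 1) * (neg_binom_coeff c m * (1 - t) ^ m)))
         = ennreal (t powr (a - c - 1) * (1 - t) powr (b - 1))"
        using assms True by (intro suminf_ennreal_eq) (auto intro!: mult_nonneg_nonneg neg_binom_coeff_nonneg)
      moreover have "ennreal (neg_binom_coeff c m) * (ennreal (t powr (a - 1) * (1 - t) powr (b + real m - 1)) * indicator {0<..<1} t)
        = ennreal (t powr (a - 1) * (1 - t) powr (b - 1) * (neg_binom_coeff c m * (1 - t) ^ m))" for m
      proof -
        have "(1 - t) powr (b + real m - 1) = (1 - t) powr (b - 1) * (1 - t) ^ m"
          using True by (simp add: powr_realpow[symmetric] powr_add[symmetric] algebra_simps)
        then show ?thesis
          using True assms by (simp add: ennreal_mult[symmetric] neg_binom_coeff_nonneg mult_ac)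
      qed
      ultimately show ?thesis using True by simp
    qed simp
  qed
  also have "\<dots> = ennreal (Beta (a - c) b)" by (rule nn_integral_Beta) (use assms in auto)
  finally show ?thesis .
qed

text \<open>Multiplied by d this is 1 / binom(d+k, d), so it identifies the normalized moments of
  \<open>cos_sq\<close> with Beta values.\<close>

lemma Beta_of_nat:
  assumes "d \<ge> 1"
  shows "Beta (real d) (real k + 1) = fact k * fact (d - 1) / fact (d + k)"
proof -
  obtain d' where d: "d = Suc d'" using assms by (cases d) auto
  have "Gamma (real d) = fact (d - 1)" "Gamma (real k + 1) = fact k"
    "Gamma (real d + (real k + 1)) = fact (d + k)"
    using Gamma_fact[of d', where 'a = real] Gamma_fact[of k, where 'a = real]
      Gamma_fact[of "d + k", where 'a = real]
    by (simp_all add: d add_ac)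
  then show ?thesis by (simp add: Beta_def mult.commute)
qed

text \<open>The factor \<open>cos_sq\<close> to the power L merely shifts the moment index from m to
  L + m, whence the second argument L + 1. The case L = 0 serves the product of the diagonal kernels
  and the continuous energy, the general case serves |K(z,w)|^2.\<close>

lemma nn_integral_energy:
  assumes d: "d \<ge> 1" and s: "0 < s" "s < 2 * real d"
  shows "(\<integral>\<^sup>+w. ennreal (1 / sin_dP d (psi z) (psi w) powr s * cos_sq d z w ^ L) \<partial>fs_vol d)
     = ennreal (pi ^ d / fact d * (real d * Beta (real d - s / 2) (real L + 1)))"
proof -
  have "(\<integral>\<^sup>+w. ennreal (1 / sin_dP d (psi z) (psi w) powr s * cos_sq d z w ^ L) \<partial>fs_vol d)
     = (\<integral>\<^sup>+w. (\<Sum>m. ennreal (neg_binom_coeff (s / 2) m) * ennreal (cos_sq d z w ^ (L + m))) \<partial>fs_vol d)"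
  proof (rule nn_integral_cong_AE)
    \<comment> \<open>Where \<open>cos_sq\<close> is 1 the two sides disagree: the left side is 0
      because of 1 / 0 = 0, while the series diverges. Hence equality is claimed almost everywhere
      only.\<close>
    show "AE w in fs_vol d. ennreal (1 / sin_dP d (psi z) (psi w) powr s * cos_sq d z w ^ L)
       = (\<Sum>m. ennreal (neg_binom_coeff (s / 2) m) * ennreal (cos_sq d z w ^ (L + m)))"
      using AE_cos_sq_less_1[OF d, of z]
    proof eventually_elim
      case (elim w)
      let ?c = "cos_sq d z w"
      have "(\<lambda>m. ?c ^ L * (neg_binom_coeff (s / 2) m * ?c ^ m)) sums (?c ^ L * (1 - ?c) powr (- (s / 2)))"
        by (intro sums_mult neg_binom_sums elim) simp
      then have "(\<Sum>m. ennreal (?c ^ L * (neg_binom_coeff (s / 2) m * ?c ^ m))) = ennreal (?c ^ L * (1 - ?c) powr (- (s / 2)))"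
        using s by (intro suminf_ennreal_eq) (auto intro!: mult_nonneg_nonneg neg_binom_coeff_nonneg)
      moreover have "ennreal (?c ^ L * (neg_binom_coeff (s / 2) m * ?c ^ m)) = ennreal (neg_binom_coeff (s / 2) m) * ennreal (?c ^ (L + m))" for m
        using s by (simp add: ennreal_mult[symmetric] neg_binom_coeff_nonneg power_add mult_ac)
      moreover have "1 / sin_dP d (psi z) (psi w) powr s = (1 - ?c) powr (- (s / 2))"
        using elim by (simp add: sin_dP_psi powr_half_sqrt[symmetric] powr_powr powr_minus_divide)
      ultimately show ?case by (simp add: mult.commute)
    qed
  qed
  also have "\<dots> = (\<Sum>m. ennreal (neg_binom_coeff (s / 2) m) * (\<integral>\<^sup>+w. ennreal (cos_sq d z w ^ (L + m)) \<partial>fs_vol d))"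
    by (subst nn_integral_suminf, measurable) (subst nn_integral_cmult, measurable)
  also have "\<dots> = (\<Sum>m. ennreal (pi ^ d / fact d * real d) * ennreal (neg_binom_coeff (s / 2) m * Beta (real d) ((real L + 1) + real m)))"
  proof (rule suminf_cong)
    fix m
    have "(real L + 1) + real m = real (L + m) + 1" by simp
    then have "Beta (real d) ((real L + 1) + real m) = fact (L + m) * fact (d - 1) / fact (d + (L + m))"
      by (simp only: Beta_of_nat[OF d])
    moreover have "fact d = real d * fact (d - 1)" using d by (simp add: fact_reduce)
    ultimately have "pi ^ d * fact (L + m) / fact (d + (L + m)) = pi ^ d / fact d * real d * Beta (real d) ((real L + 1) + real m)"
      using d by simp
    then show "ennreal (neg_binom_coeff (s / 2) m) * (\<integral>\<^sup>+w. ennreal (cos_sq d z w ^ (L + m)) \<partial>fs_vol d)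
      = ennreal (pi ^ d / fact d * real d) * ennreal (neg_binom_coeff (s / 2) m * Beta (real d) ((real L + 1) + real m))"
      unfolding nn_integral_cos_sq_power using s
      by (simp add: ennreal_mult'[symmetric] neg_binom_coeff_nonneg mult_ac)
  qed
  also have "\<dots> = ennreal (pi ^ d / fact d * real d) * ennreal (Beta (real d - s / 2) (real L + 1))"
    using s by (subst ennreal_suminf_cmult, subst suminf_neg_binom_Beta) auto
  also have "\<dots> = ennreal (pi ^ d / fact d * (real d * Beta (real d - s / 2) (real L + 1)))"
    by (subst ennreal_mult'[symmetric]) (auto simp: mult_ac)
  finally show ?thesis .
qed

section \<open>Expected energy\<close>

lemma sin_dP_psi_measurable [measurable]:
  "(\<lambda>(z,w). sin_dP d (psi z) (psi w)) \<in> borel_measurable (PiM {..<d} (\<lambda>_. borel) \<Otimes>\<^sub>M PiM {..<d} (\<lambda>_. borel))"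
  unfolding sin_dP_psi by measurable

text \<open>The inner integral does not depend on the base point, so the outer integration
  contributes just the total volume. Nonnegativity turns the Tonelli computation into
  integrability.\<close>

lemma has_bochner_integral_energy_pair:
  assumes d: "d \<ge> 1" and s: "0 < s" "s < 2 * real d"
  shows "has_bochner_integral (chart_leb d \<Otimes>\<^sub>M chart_leb d)
      (\<lambda>(z,w). 1 / sin_dP d (psi z) (psi w) powr s * cos_sq d z w ^ L * (fs_weight d z * fs_weight d w))
      ((pi ^ d / fact d)\<^sup>2 * (real d * Beta (real d - s / 2) (real L + 1)))"
proof (rule has_bochner_integral_nn_integral)
  interpret C: sigma_finite_measure "chart_leb d" by (rule sigma_finite_chart_leb)
  let ?F = "\<lambda>z w. 1 / sin_dP d (psi z) (psi w) powr s * cos_sq d z w ^ L"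
  let ?B = "pi ^ d / fact d * (real d * Beta (real d - s / 2) (real L + 1))"
  have B: "?B \<ge> 0" using s by (simp add: Beta_def Gamma_real_pos less_imp_le)
  have sets2 [measurable_cong]: "sets (chart_leb d \<Otimes>\<^sub>M chart_leb d) = sets (PiM {..<d} (\<lambda>_. borel) \<Otimes>\<^sub>M PiM {..<d} (\<lambda>_. borel))"
    by (intro sets_pair_measure_cong sets_chart_leb)
  have F[measurable]: "(\<lambda>(z,w). ?F z w) \<in> borel_measurable (PiM {..<d} (\<lambda>_. borel) \<Otimes>\<^sub>M PiM {..<d} (\<lambda>_. borel))"
    by measurable
  then show Fm: "(\<lambda>(z,w). ?F z w * (fs_weight d z * fs_weight d w)) \<in> borel_measurable (chart_leb d \<Otimes>\<^sub>M chart_leb d)"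
    by measurable
  show "AE zw in chart_leb d \<Otimes>\<^sub>M chart_leb d. 0 \<le> (case zw of (z,w) \<Rightarrow> ?F z w * (fs_weight d z * fs_weight d w))"
    by (auto intro!: AE_I2)
  show "0 \<le> (pi ^ d / fact d)\<^sup>2 * (real d * Beta (real d - s / 2) (real L + 1))"
    using s by (simp add: Beta_def Gamma_real_pos less_imp_le)
  have "(\<integral>\<^sup>+zw. ennreal (case zw of (z,w) \<Rightarrow> ?F z w * (fs_weight d z * fs_weight d w)) \<partial>(chart_leb d \<Otimes>\<^sub>M chart_leb d))
    = (\<integral>\<^sup>+z. \<integral>\<^sup>+w. ennreal (?F z w * (fs_weight d z * fs_weight d w)) \<partial>chart_leb d \<partial>chart_leb d)"
    by (subst C.nn_integral_fst[symmetric]) (use measurable_compose[OF Fm measurable_ennreal] in simp_all)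
  also have "\<dots> = (\<integral>\<^sup>+z. ennreal (fs_weight d z) * ennreal ?B \<partial>chart_leb d)"
  proof (rule nn_integral_cong)
    fix z assume z: "z \<in> space (chart_leb d)"
    then have z': "z \<in> space (PiM {..<d} (\<lambda>_. borel))" by (simp add: chart_leb_def space_PiM)
    have [measurable]: "?F z \<in> borel_measurable (PiM {..<d} (\<lambda>_. borel))"
      using measurable_Pair2[OF F z'] by simp
    have "(\<integral>\<^sup>+w. ennreal (?F z w * (fs_weight d z * fs_weight d w)) \<partial>chart_leb d)
       = (\<integral>\<^sup>+w. ennreal (fs_weight d z) * (ennreal (fs_weight d w) * ennreal (?F z w)) \<partial>chart_leb d)"
      by (intro nn_integral_cong) (simp add: ennreal_mult[symmetric] mult_ac)
    also have "\<dots> = ennreal (fs_weight d z) * (\<integral>\<^sup>+w. ennreal (?F z w) \<partial>fs_vol d)"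
      by (subst nn_integral_fs_vol, measurable) (subst nn_integral_cmult, measurable)
    finally show "(\<integral>\<^sup>+w. ennreal (?F z w * (fs_weight d z * fs_weight d w)) \<partial>chart_leb d) = ennreal (fs_weight d z) * ennreal ?B"
      by (simp only: nn_integral_energy[OF d s])
  qed
  also have "\<dots> = (\<integral>\<^sup>+z. ennreal ?B \<partial>fs_vol d)"
    by (subst nn_integral_fs_vol) auto
  also have "\<dots> = ennreal ((pi ^ d / fact d)\<^sup>2 * (real d * Beta (real d - s / 2) (real L + 1)))"
    using B by (simp add: emeasure_fs_vol ennreal_mult''[symmetric] power2_eq_square mult_ac)
  finally show "(\<integral>\<^sup>+zw. ennreal (case zw of (z,w) \<Rightarrow> ?F z w * (fs_weight d z * fs_weight d w)) \<partial>(chart_leb d \<Otimes>\<^sub>M chart_leb d))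
    = ennreal ((pi ^ d / fact d)\<^sup>2 * (real d * Beta (real d - s / 2) (real L + 1)))" .
qed

lemma H_dL_measurable:
  assumes "f \<in> H_dL d L"
  shows "f \<in> borel_measurable (PiM {..<d} (\<lambda>_. borel))"
  using assms by (auto simp: H_dL_def)

lemma Beta_1_right:
  fixes a :: real
  assumes "a > 0"
  shows "Beta a 1 = 1 / a"
proof -
  have "a \<notin> \<int>\<^sub>\<le>\<^sub>0" using nonpos_Ints_nonpos[of a] assms by auto
  then show ?thesis using Gamma_real_pos[OF assms] by (simp add: Beta_def Gamma_plus1)
qed

lemma rL_eq_fact: "real (rL d L) = fact (d + L) / (fact d * fact L)"
  by (simp add: rL_def binomial_fact)

text \<open>The pair formula has complex integrands and the complex determinant, while the ensemble
  is defined through \<open>ennreal\<close> of a real part; \<open>D'\<close> mediates between the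
  two. After that only K(x,x) K(y,y) and |K(x,y)|^2 enter, both independent of the basis.\<close>

lemma expected_energy_eq:
  assumes d: "d \<ge> 1" and s: "0 < s" "s < 2 * real d" and onb: "is_onb d L \<phi>"
  shows "expected_energy d s L \<phi> = real d / (real d - s / 2) * real (rL d L) ^ 2
             - real (rL d L) ^ 2 * real d * Beta (real d - s / 2) (real L + 1)"
proof -
  interpret C: sigma_finite_measure "chart_leb d" by (rule sigma_finite_chart_leb)
  define r where "r = rL d L"
  define K where "K = kern r \<phi>"
  define c :: real where "c = fact (d + L) / (pi ^ d * fact L)"
  define F where "F = (\<lambda>z w. 1 / sin_dP d (psi z) (psi w) powr s)"
  define P where "P = PiM {..<r} (\<lambda>_. chart_leb d)"
  define B where "B k = real d * Beta (real d - s / 2) (real k + 1)" for k :: nat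
  have c: "c > 0" by (simp add: c_def)
  have F_nonneg: "F z w \<ge> 0" for z w by (simp add: F_def)
  have sets2 [measurable_cong]: "sets (chart_leb d \<Otimes>\<^sub>M chart_leb d) = sets (PiM {..<d} (\<lambda>_. borel) \<Otimes>\<^sub>M PiM {..<d} (\<lambda>_. borel))"
    by (intro sets_pair_measure_cong sets_chart_leb)
  have setsP [measurable_cong]: "sets P = sets (PiM {..<r} (\<lambda>_. PiM {..<d} (\<lambda>_. borel)))"
    unfolding P_def by (intro sets_PiM_cong refl sets_chart_leb)
  have \<phi>m: "\<phi> k \<in> borel_measurable (PiM {..<d} (\<lambda>_. borel))" if "k < r" for k
    using onb that by (intro H_dL_measurable[of _ d L]) (auto simp: is_onb_def r_def)
  have F_meas [measurable]: "(\<lambda>(z,w). F z w) \<in> borel_measurable (PiM {..<d} (\<lambda>_. borel) \<Otimes>\<^sub>M PiM {..<d} (\<lambda>_. borel))"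
    unfolding F_def by measurable
  have Keq: "K z w = proj_kernel d L z w" for z w
    unfolding K_def r_def by (rule is_onb_kern[OF onb])
  \<comment> \<open>A pointwise bound on an unknown basis: each |\<phi>_k|^2 is one summand of
    K(z,z), which is known in closed form.\<close>
  have \<phi>_bound: "cmod (\<phi> k z) ^ 2 \<le> c * fs_weight d z" if "k < r" for k z
  proof -
    have "of_real (\<Sum>k<r. (cmod (\<phi> k z))\<^sup>2) = K z z"
      by (simp add: K_def kern_def complex_norm_square[symmetric])
    also have "\<dots> = of_real (c * fs_weight d z)" unfolding Keq c_def by (rule proj_kernel_diag)
    finally have "(\<Sum>k<r. (cmod (\<phi> k z))\<^sup>2) = c * fs_weight d z" by (simp only: of_real_eq_iff)
    moreover have "(cmod (\<phi> k z))\<^sup>2 \<le> (\<Sum>k<r. (cmod (\<phi> k z))\<^sup>2)"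
      using that by (intro member_le_sum) auto
    ultimately show ?thesis by simp
  qed
  have \<phi>\<phi>_bound: "cmod (\<phi> k z) * cmod (\<phi> l z) \<le> c * fs_weight d z" if "k < r" "l < r" for k l z
    using sum_squares_bound[of "cmod (\<phi> k z)" "cmod (\<phi> l z)"] \<phi>_bound[OF that(1), of z] \<phi>_bound[OF that(2), of z]
    by linarith
  have pair: "has_bochner_integral (chart_leb d \<Otimes>\<^sub>M chart_leb d)
      (\<lambda>(z,w). F z w * cos_sq d z w ^ k * (fs_weight d z * fs_weight d w)) ((pi ^ d / fact d)\<^sup>2 * B k)" for k
    unfolding F_def B_def by (rule has_bochner_integral_energy_pair[OF d s])
  \<comment> \<open>The dominating function is the pair integrand with \<open>cos_sq\<close> to the
    power 0, whose integrability is where s < 2d enters.\<close>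
  have int: "integrable (chart_leb d \<Otimes>\<^sub>M chart_leb d)
      (\<lambda>(x,y). complex_of_real (F x y) * (\<phi> k x * cnj (\<phi> k' x)) * (\<phi> l y * cnj (\<phi> l' y)))"
    if "k < r" "k' < r" "l < r" "l' < r" for k k' l l'
  proof (rule Bochner_Integration.integrable_bound)
    show "integrable (chart_leb d \<Otimes>\<^sub>M chart_leb d) (\<lambda>z. c\<^sup>2 * (case z of (z,w) \<Rightarrow> F z w * cos_sq d z w ^ 0 * (fs_weight d z * fs_weight d w)))"
      using pair[of 0] by (intro integrable_mult_right) (auto simp: has_bochner_integral_iff)
    note [measurable] = \<phi>m[OF that(1)] \<phi>m[OF that(2)] \<phi>m[OF that(3)] \<phi>m[OF that(4)]
    show "(\<lambda>(x,y). complex_of_real (F x y) * (\<phi> k x * cnj (\<phi> k' x)) * (\<phi> l y * cnj (\<phi> l' y)))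
        \<in> borel_measurable (chart_leb d \<Otimes>\<^sub>M chart_leb d)" by measurable
    have "F x y * ((cmod (\<phi> k x) * cmod (\<phi> k' x)) * (cmod (\<phi> l y) * cmod (\<phi> l' y)))
        \<le> F x y * ((c * fs_weight d x) * (c * fs_weight d y))" for x y
      using that c F_nonneg by (intro mult_left_mono mult_mono \<phi>\<phi>_bound) auto
    then show "AE z in chart_leb d \<Otimes>\<^sub>M chart_leb d.
       norm (case z of (x,y) \<Rightarrow> complex_of_real (F x y) * (\<phi> k x * cnj (\<phi> k' x)) * (\<phi> l y * cnj (\<phi> l' y)))
       \<le> norm (c\<^sup>2 * (case z of (z,w) \<Rightarrow> F z w * cos_sq d z w ^ 0 * (fs_weight d z * fs_weight d w)))"
      using F_nonneg c
      by (intro AE_I2) (simp add: norm_mult power2_eq_square mult_ac abs_mult split: prod.split)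
  qed
  \<comment> \<open>The diagonal product gives the power 0 of \<open>cos_sq\<close> and |K(x,y)|^2
    the power L, both with the constant c^2 and the same two weights.\<close>
  have Kint: "(\<integral>(x,y). complex_of_real (F x y) * (K x x * K y y - K x y * K y x) \<partial>(chart_leb d \<Otimes>\<^sub>M chart_leb d))
      = of_real (c\<^sup>2 * ((pi ^ d / fact d)\<^sup>2 * B 0) - c\<^sup>2 * ((pi ^ d / fact d)\<^sup>2 * B L))"
  proof -
    have "has_bochner_integral (chart_leb d \<Otimes>\<^sub>M chart_leb d) (\<lambda>z. complex_of_real (
          c\<^sup>2 * (case z of (z,w) \<Rightarrow> F z w * cos_sq d z w ^ 0 * (fs_weight d z * fs_weight d w))
          - c\<^sup>2 * (case z of (z,w) \<Rightarrow> F z w * cos_sq d z w ^ L * (fs_weight d z * fs_weight d w))))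
        (of_real (c\<^sup>2 * ((pi ^ d / fact d)\<^sup>2 * B 0) - c\<^sup>2 * ((pi ^ d / fact d)\<^sup>2 * B L)))"
      by (intro has_bochner_integral_of_real has_bochner_integral_diff has_bochner_integral_mult_right pair)
    also have "(\<lambda>z. complex_of_real (
          c\<^sup>2 * (case z of (z,w) \<Rightarrow> F z w * cos_sq d z w ^ 0 * (fs_weight d z * fs_weight d w))
          - c\<^sup>2 * (case z of (z,w) \<Rightarrow> F z w * cos_sq d z w ^ L * (fs_weight d z * fs_weight d w))))
       = (\<lambda>(x,y). complex_of_real (F x y) * (K x x * K y y - K x y * K y x))"
    proof (intro ext, clarify)
      fix x y
      have "K y x = cnj (K x y)" by (simp add: K_def kern_def mult.commute)
      then have "K x y * K y x = of_real ((cmod (K x y))\<^sup>2)" by (simp only: complex_norm_square)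
      also have "\<dots> = of_real (c\<^sup>2 * fs_weight d x * (fs_weight d y * cos_sq d x y ^ L))"
        unfolding Keq cmod_proj_kernel_sq c_def ..
      finally have 1: "K x y * K y x = of_real (c\<^sup>2 * fs_weight d x * (fs_weight d y * cos_sq d x y ^ L))" .
      have 2: "K x x = of_real (c * fs_weight d x)" for x unfolding Keq c_def by (rule proj_kernel_diag)
      show "complex_of_real (c\<^sup>2 * (F x y * cos_sq d x y ^ 0 * (fs_weight d x * fs_weight d y))
          - c\<^sup>2 * (F x y * cos_sq d x y ^ L * (fs_weight d x * fs_weight d y)))
        = complex_of_real (F x y) * (K x x * K y y - K x y * K y x)"
        unfolding 1 2 by (simp add: power2_eq_square algebra_simps)
    qed
    finally show ?thesis by (rule has_bochner_integral_integral_eq)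
  qed
  define E where "E \<omega> = (\<Sum>a<r. \<Sum>b<r. if a \<noteq> b then complex_of_real (F (\<omega> a) (\<omega> b)) else 0)" for \<omega>
  define D where "D \<omega> = det (mat r r (\<lambda>(i,j). K (\<omega> i) (\<omega> j)))" for \<omega>
  have main: "has_bochner_integral P (\<lambda>\<omega>. E \<omega> * D \<omega>)
     (fact r * of_real (c\<^sup>2 * ((pi ^ d / fact d)\<^sup>2 * B 0) - c\<^sup>2 * ((pi ^ d / fact d)\<^sup>2 * B L)))"
    unfolding Kint[symmetric] P_def E_def D_def K_def kern_def
    by (rule C.has_bochner_integral_determinantal_pair)
       (use is_onb_has_bochner_integral[OF onb] int in \<open>auto simp: r_def\<close>)
  have E: "E \<omega> = of_real (energyP d s r \<omega>)" for \<omega>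
    unfolding E_def energyP_def F_def of_real_sum by (intro sum.cong refl) auto
  \<comment> \<open>The Slater-type determinant of the entries \<open>\<phi> j (\<omega> i)\<close>.
    As \<open>D\<close> is its squared modulus, taking \<open>Re\<close> and \<open>ennreal\<close>
    loses nothing, and measurability of the density reduces to that of the basis functions.\<close>
  define D' where "D' \<omega> = (\<Sum>p | p permutes {..<r}. of_int (sign p) * (\<Prod>i<r. \<phi> (p i) (\<omega> i)))" for \<omega>
  have DD': "D \<omega> = D' \<omega> * cnj (D' \<omega>)" for \<omega>
    unfolding D_def D'_def K_def kern_def by (rule det_gram)
  then have D: "D \<omega> = of_real ((cmod (D' \<omega>))\<^sup>2)" for \<omega> by (simp only: complex_norm_square)
  have D'm [measurable]: "D' \<in> borel_measurable P"
    unfolding D'_def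
  proof (intro borel_measurable_sum borel_measurable_times borel_measurable_const borel_measurable_prod)
    fix p i assume "p \<in> {p. p permutes {..<r}}" "i \<in> {..<r}"
    then have "p i < r" "i < r" using permutes_in_image[of p "{..<r}" i] by auto
    from \<phi>m[OF this(1)] show "(\<lambda>\<omega>. \<phi> (p i) (\<omega> i)) \<in> borel_measurable P"
      by (rule measurable_compose[rotated])
         (use \<open>i < r\<close> in \<open>simp add: measurable_cong_sets[OF setsP refl] measurable_component_singleton\<close>)
  qed
  have Em [measurable]: "energyP d s r \<in> borel_measurable P"
    unfolding energyP_def F_def[symmetric]
  proof (intro borel_measurable_sum)
    fix i j assume [measurable]: "i \<in> {..<r}" "j \<in> {..<r}"
    show "(\<lambda>\<omega>. if i \<noteq> j then 1 / sin_dP d (psi (\<omega> i)) (psi (\<omega> j)) powr s else 0) \<in> borel_measurable P"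
      by measurable
  qed
  have "proj_ensemble d L \<phi> = density P (\<lambda>\<omega>. ennreal ((cmod (D' \<omega>))\<^sup>2 / fact r))"
    unfolding proj_ensemble_def r_def[symmetric] P_def[symmetric] K_def[symmetric] D_def[symmetric] D by simp
  then have "expected_energy d s L \<phi> = (\<integral>\<omega>. (cmod (D' \<omega>))\<^sup>2 / fact r * energyP d s r \<omega> \<partial>P)"
    unfolding expected_energy_def r_def[symmetric] by (simp add: integral_density)
  also have "\<dots> = (\<integral>\<omega>. Re (E \<omega> * D \<omega>) / fact r \<partial>P)"
    unfolding E D by (intro Bochner_Integration.integral_cong refl) simp
  also have "\<dots> = (c\<^sup>2 * ((pi ^ d / fact d)\<^sup>2 * B 0) - c\<^sup>2 * ((pi ^ d / fact d)\<^sup>2 * B L))"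
  proof -
    have "Re (fact r * of_real v) / fact r = v" for v
    proof -
      have "fact r * of_real v = complex_of_real (fact r * v)" by simp
      then show ?thesis by (simp only: Re_complex_of_real) simp
    qed
    then show ?thesis
      using has_bochner_integral_divide_zero[OF has_bochner_integral_bounded_linear[OF bounded_linear_Re main], of "fact r"]
      by (simp only: has_bochner_integral_integral_eq)
  qed
  \<comment> \<open>The constant intensity c times the total volume pi^d / d! is r, the number of
    points.\<close>
  also have "\<dots> = real r ^ 2 * B 0 - real r ^ 2 * B L"
  proof -
    have "c\<^sup>2 * ((pi ^ d / fact d)\<^sup>2 * x) = real r ^ 2 * x" for x
      by (simp add: c_def r_def rL_eq_fact power2_eq_square mult_ac)
    then show ?thesis by (simp only:)
  qed
  finally have 1: "expected_energy d s L \<phi> = real r ^ 2 * B 0 - real r ^ 2 * B L" .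
  have 2: "B 0 = real d / (real d - s / 2)"
    using s Beta_1_right[of "real d - s / 2"] by (simp add: B_def)
  show ?thesis unfolding 1 2 unfolding r_def B_def by (simp only: mult_ac)
qed

section \<open>Asymptotics\<close>

text \<open>Since B(a, n+1) = n! / (a (a+1) ... (a+n)), the sequence is Euler's limit formula for
  Gamma.\<close>

lemma powr_mult_Beta_tendsto_Gamma:
  fixes a :: real
  assumes a: "a > 0"
  shows "(\<lambda>n. real n powr a * Beta a (real n + 1)) \<longlonglongrightarrow> Gamma a"
proof (rule Lim_transform_eventually[OF Gamma_series_LIMSEQ])
  have na: "a \<notin> \<int>\<^sub>\<le>\<^sub>0" using nonpos_Ints_nonpos[of a] a by auto
  show "eventually (\<lambda>n. Gamma_series a n = real n powr a * Beta a (real n + 1)) sequentially"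
    using eventually_gt_at_top[of 0]
  proof eventually_elim
    case (elim n)
    have "Gamma (a + (real n + 1)) = pochhammer a (n + 1) * Gamma a"
      using pochhammer_Gamma[OF na, of "n + 1"] Gamma_real_pos[OF a] by (simp add: add_ac)
    moreover have "Gamma (real n + 1) = fact n" using Gamma_fact[of n, where 'a = real] by (simp add: add.commute)
    ultimately have "Beta a (real n + 1) = fact n / pochhammer a (n + 1)"
      using Gamma_real_pos[OF a] by (simp add: Beta_def)
    then show ?case using elim by (simp add: Gamma_series_def powr_def mult_ac)
  qed
qed

lemma rL_pos: "real (rL d L) > 0"
  by (simp add: rL_eq_fact)

text \<open>As 1/r = d B(d, L+1), the growth of r is the preceding limit at a = d.\<close>

lemma powr_div_rL_tendsto:
  assumes d: "d \<ge> 1"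
  shows "(\<lambda>L. real L powr real d / real (rL d L)) \<longlonglongrightarrow> fact d"
proof -
  have fd: "fact d = real d * fact (d - 1)" using d by (simp add: fact_reduce)
  have "(\<lambda>L. real d * (real L powr real d * Beta (real d) (real L + 1))) \<longlonglongrightarrow> real d * Gamma (real d)"
    by (intro tendsto_mult_left powr_mult_Beta_tendsto_Gamma) (use d in simp)
  moreover have "real d * (real L powr real d * Beta (real d) (real L + 1)) = real L powr real d / real (rL d L)" for L
    unfolding Beta_of_nat[OF d] rL_eq_fact fd by simp
  moreover have "real d * Gamma (real d) = fact d"
    using Gamma_fact[of "d - 1", where 'a = real] d fd by simp
  ultimately show ?thesis by simp
qed

text \<open>Because d (1 - s/(2d)) = d - s/2, the power of r in front grows exactly like the power
  of L that normalizes the Beta value. Replacing L by r produces the power of d! in the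
  denominator.\<close>

lemma energy_correction_tendsto:
  assumes d: "d \<ge> 1" and s: "s < 2 * real d"
  shows "(\<lambda>L. real (rL d L) powr (1 - s / (2 * real d)) * Beta (real d - s / 2) (real L + 1))
     \<longlonglongrightarrow> Gamma (real d - s / 2) / fact d powr (1 - s / (2 * real d))"
proof (rule Lim_transform_eventually)
  let ?x = "real d - s / 2" and ?b = "1 - s / (2 * real d)"
  show "(\<lambda>L. real L powr ?x * Beta ?x (real L + 1) / (real L powr real d / real (rL d L)) powr ?b)
     \<longlonglongrightarrow> Gamma ?x / fact d powr ?b"
    by (intro tendsto_divide powr_mult_Beta_tendsto_Gamma tendsto_powr powr_div_rL_tendsto tendsto_const)
       (use d s in auto)
  show "eventually (\<lambda>L. real L powr ?x * Beta ?x (real L + 1) / (real L powr real d / real (rL d L)) powr ?b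
     = real (rL d L) powr ?b * Beta ?x (real L + 1)) sequentially"
    using eventually_gt_at_top[of 0]
  proof eventually_elim
    case (elim L)
    have "real d * ?b = ?x" using d by (simp add: field_simps)
    then have "(real L powr real d / real (rL d L)) powr ?b = real L powr ?x / real (rL d L) powr ?b"
      using rL_pos[of d L] by (subst powr_divide) (auto simp: powr_powr)
    then show ?case using elim rL_pos[of d L] by simp
  qed
qed

theorem theorem3p3:
  fixes d :: nat and s :: real and \<phi> :: "nat \<Rightarrow> nat \<Rightarrow> cpt \<Rightarrow> complex"
  assumes "d \<ge> 1" and "0 < s" and "s < 2 * real d"
    and "\<forall>L\<ge>1. is_onb d L (\<phi> L)"
  shows "(\<forall>L\<ge>1. expected_energy d s L (\<phi> L) =
             real d / (real d - s / 2) * real (rL d L) ^ 2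
             - real (rL d L) ^ 2 * real d * Beta (real d - s / 2) (real L + 1))
    \<and> (\<lambda>L. expected_energy d s L (\<phi> L)
           - (real d / (real d - s / 2) * real (rL d L) ^ 2
              - real (rL d L) powr (1 + s / (2 * real d)) * real d * Gamma (real d - s / 2)
                / (fact d) powr (1 - s / (2 * real d))))
       \<in> o(\<lambda>L. real (rL d L) powr (1 + s / (2 * real d)))
    \<and> real d / (real d - s / 2) =
       (\<integral>p. \<integral>q. 1 / (sin_dP d (psi p) (psi q)) powr s \<partial>fs_vol d \<partial>fs_vol d)
         / (measure (fs_vol d) (space (fs_vol d)))^2"
proof (intro conjI allI impI)
  show energy: "expected_energy d s L (\<phi> L) =
             real d / (real d - s / 2) * real (rL d L) ^ 2
             - real (rL d L) ^ 2 * real d * Beta (real d - s / 2) (real L + 1)" if "L \<ge> 1" for L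
    using expected_energy_eq assms that by blast
  let ?e = "1 + s / (2 * real d)" and ?b = "1 - s / (2 * real d)"
  let ?g = "Gamma (real d - s / 2) / fact d powr ?b"
  show "(\<lambda>L. expected_energy d s L (\<phi> L)
           - (real d / (real d - s / 2) * real (rL d L) ^ 2
              - real (rL d L) powr ?e * real d * Gamma (real d - s / 2) / (fact d) powr ?b))
       \<in> o(\<lambda>L. real (rL d L) powr ?e)"
  proof (rule smalloI_tendsto)
    have "(\<lambda>L. real d * (?g - real (rL d L) powr ?b * Beta (real d - s / 2) (real L + 1))) \<longlonglongrightarrow> real d * (?g - ?g)"
      by (intro tendsto_intros energy_correction_tendsto assms)
    then have "(\<lambda>L. real d * (?g - real (rL d L) powr ?b * Beta (real d - s / 2) (real L + 1))) \<longlonglongrightarrow> 0"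
      by simp
    moreover have "eventually (\<lambda>L. real d * (?g - real (rL d L) powr ?b * Beta (real d - s / 2) (real L + 1))
       = (expected_energy d s L (\<phi> L)
           - (real d / (real d - s / 2) * real (rL d L) ^ 2
              - real (rL d L) powr ?e * real d * Gamma (real d - s / 2) / (fact d) powr ?b))
         / real (rL d L) powr ?e) sequentially"
      using eventually_ge_at_top[of 1]
    proof eventually_elim
      case (elim L)
      let ?r = "real (rL d L)"
      \<comment> \<open>The exponents satisfy e + b = 2, so dividing the correction r^2 B by r^e
        leaves r^b B, whose limit is known.\<close>
      have "?r ^ 2 = ?r powr (?e + ?b)" using rL_pos[of d L] by simp
      then have "?r ^ 2 = ?r powr ?e * ?r powr ?b" by (simp only: powr_add)
      moreover have "?r powr ?e > 0" using rL_pos[of d L] by simp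
      ultimately show ?case unfolding energy[OF elim] by (simp add: field_simps)
    qed
    ultimately show "((\<lambda>L. (expected_energy d s L (\<phi> L)
           - (real d / (real d - s / 2) * real (rL d L) ^ 2
              - real (rL d L) powr ?e * real d * Gamma (real d - s / 2) / (fact d) powr ?b))
         / real (rL d L) powr ?e) \<longlongrightarrow> 0) sequentially"
      by (rule Lim_transform_eventually)
    show "eventually (\<lambda>L. real (rL d L) powr ?e \<noteq> 0) sequentially"
    proof (rule always_eventually, rule allI)
      show "real (rL d L) powr ?e \<noteq> 0" for L using rL_pos[of d L] by simp
    qed
  qed
  define V :: real where "V = pi ^ d / fact d"
  have V: "V > 0" by (simp add: V_def)
  have m: "measure (fs_vol d) (space (fs_vol d)) = V"
    using V by (simp add: measure_def emeasure_fs_vol V_def)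
  \<comment> \<open>The case L = 0 of the energy integral: the value is the same for every p, so the
    outer integral only adds another factor V.\<close>
  have "(\<integral>q. 1 / (sin_dP d (psi p) (psi q)) powr s \<partial>fs_vol d) = V * (real d / (real d - s / 2))" for p
  proof -
    have [measurable]: "(\<lambda>q. sin_dP d (psi p) (psi q)) \<in> borel_measurable (PiM {..<d} (\<lambda>_. borel))"
      unfolding sin_dP_psi by measurable
    have "(\<integral>q. 1 / (sin_dP d (psi p) (psi q)) powr s \<partial>fs_vol d)
       = enn2real (\<integral>\<^sup>+q. ennreal (1 / (sin_dP d (psi p) (psi q)) powr s) \<partial>fs_vol d)"
      by (rule integral_eq_nn_integral) auto
    also have "\<dots> = enn2real (ennreal (V * (real d / (real d - s / 2))))"
      using nn_integral_energy[OF assms(1-3), of p 0] Beta_1_right[of "real d - s / 2"] assms(3)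
      by (simp add: V_def)
    also have "\<dots> = V * (real d / (real d - s / 2))"
      using V assms(3) by (intro enn2real_ennreal) auto
    finally show ?thesis .
  qed
  then show "real d / (real d - s / 2) =
       (\<integral>p. \<integral>q. 1 / (sin_dP d (psi p) (psi q)) powr s \<partial>fs_vol d \<partial>fs_vol d)
         / (measure (fs_vol d) (space (fs_vol d)))^2"
    using V by (simp add: m power2_eq_square)
qed

end
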